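(* Let $\Omega\subset\mathbb R^2$ be an open bounded domain, and let $\gamma\ne0$. Consider the equation $$c^2\Delta\varphi-\sum_{i,j=1}^2\varphi_i\varphi_j\varphi_{ij}=|\nabla\varphi|^2-2c^2, \qquad(\ast)$$ where $c^2=-(\gamma-1)\left(\varphi+\tfrac12|\nabla\varphi|^2\right)$ if $\gamma\ne1$ and $c^2=a^2$ (a fixed constant $a>0$) if $\gamma=1$; put $L=|\nabla\varphi|/c$. (i) Suppose $\gamma\ge-1$. Let $\varphi\in C^3(\Omega)$ satisfy $(\ast)$ with $L\le1$ and $\rho>0$ in $\Omega$. Then either $L\equiv0$ in $\Omega$ or $L$ does not attain its maximum in $\Omega$. (ii) Suppose $\gamma>-1$. For any $D>0$ there exists $C_0>0$, depending only on $(\gamma,D)$, such that, if $\mathrm{diam}(\Omega)\le D$, then for any $\delta\ge0$, $\hat c\ge1$ and $b\in C^2(\Omega)$ with $|Db|+\hat c\,|D^2b|\le\frac{\delta}{\hat c}$ in $\Omega$, and for any solution $\varphi\in C^3(\Omega)$ of $(\ast)$ satisfying $L\le1$, $\rho(|D\varphi|^2,\varphi)>0$ and $c(|D\varphi|^2,\varphi)\le\hat c$ in $\Omega$, either $$L^2\le C_0\,\delta\quad\text{in }\Omega,$$ or $L^2+b$ does not attain its maximum in $\Omega$.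
   Context: Subscripts denote partial derivatives: $\varphi_i=\partial\varphi/\partial\xi_i$, $\varphi_{ij}=\partial^2\varphi/\partial\xi_i\partial\xi_j$. The equation $(\ast)$ is the self-similar potential flow equation for a gas with pressure law $p(\rho)=\frac{a^2}{\gamma}(\rho^\gamma-\underline\rho^\gamma)$, $a>0$, $\gamma\in[-1,\infty)\setminus\{0\}$, where $\rho>\underline\rho\geq 0$ ($\underline\rho>0$ if $\gamma<1$). Here $c>0$ is the sound speed, $c^2=p'(\rho)=a^2\rho^{\gamma-1}$; for $\gamma\neq 1$, the density $\rho=\rho(|D\varphi|^2,\varphi)$ is determined by this relation from $c^2=c^2(|D\varphi|^2,\varphi)=-(\gamma-1)(\varphi+\frac12|D\varphi|^2)$, so the condition $\rho>0$ includes that this expression is positive; for $\gamma=1$ the sound speed is the constant $a$. *)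

theory Defs
  imports "HOL-Analysis.Analysis"
begin

section \<open>Derivatives of functions on the plane\<close>

definition pd :: "2 \<Rightarrow> (real^2 \<Rightarrow> real) \<Rightarrow> real^2 \<Rightarrow> real" where
  "pd i f x = frechet_derivative f (at x) (axis i 1)"

definition grad :: "(real^2 \<Rightarrow> real) \<Rightarrow> real^2 \<Rightarrow> real^2" where
  "grad f x = (\<chi> i. pd i f x)"

definition hess :: "(real^2 \<Rightarrow> real) \<Rightarrow> real^2 \<Rightarrow> real^2^2" where
  "hess f x = (\<chi> i j. pd i (pd j f) x)"

definition laplacian :: "(real^2 \<Rightarrow> real) \<Rightarrow> real^2 \<Rightarrow> real" where
  "laplacian f x = (\<Sum>i\<in>UNIV. pd i (pd i f) x)"

text \<open>The class $C^k(\Omega)$ for open $\Omega$; no condition is imposed at the boundary, so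
  the derivatives may be unbounded.\<close>

primrec C_k_on :: "nat \<Rightarrow> (real^2 \<Rightarrow> real) \<Rightarrow> (real^2) set \<Rightarrow> bool" where
  "C_k_on 0 f \<Omega> \<longleftrightarrow> continuous_on \<Omega> f"
| "C_k_on (Suc k) f \<Omega> \<longleftrightarrow> f differentiable_on \<Omega> \<and> (\<forall>i. C_k_on k (pd i f) \<Omega>)"

section \<open>Self-similar potential flow\<close>

text \<open>Throughout, \<open>q\<close> stands for $|D\varphi|^2$ and \<open>z\<close> for $\varphi$.\<close>

definition sound_speed_sq :: "real \<Rightarrow> real \<Rightarrow> real \<Rightarrow> real \<Rightarrow> real" where
  "sound_speed_sq a \<gamma> q z = (if \<gamma> = 1 then a\<^sup>2 else - (\<gamma> - 1) * (z + q / 2))"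

definition sound_speed :: "real \<Rightarrow> real \<Rightarrow> real \<Rightarrow> real \<Rightarrow> real" where
  "sound_speed a \<gamma> q z = sqrt (sound_speed_sq a \<gamma> q z)"

text \<open>For $\gamma \neq 1$ the density solves $c^2 = a^2 \rho^{\gamma-1}$, which requires $c^2 > 0$;
  it is set to $0$ otherwise, so that positivity of the density entails $c^2 > 0$. For $\gamma = 1$
  it comes from Bernoulli's law $\varphi + \frac12 |D\varphi|^2 + \pi(\rho) = 0$ with
  $\pi'(\rho) = p'(\rho)/\rho = a^2/\rho$. The integration constant in $\pi$ only rescales the
  density, which is positive in any case.\<close>

definition gas_density :: "real \<Rightarrow> real \<Rightarrow> real \<Rightarrow> real \<Rightarrow> real" where
  "gas_density a \<gamma> q z =
    (if \<gamma> = 1 then exp (- (z + q / 2) / a\<^sup>2)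
     else if sound_speed_sq a \<gamma> q z > 0
       then (sound_speed_sq a \<gamma> q z / a\<^sup>2) powr (1 / (\<gamma> - 1))
     else 0)"

lemma gas_density_pos_iff:
  assumes "a > 0"
  shows "gas_density a \<gamma> q z > 0 \<longleftrightarrow> sound_speed_sq a \<gamma> q z > 0"
  using assms by (auto simp: gas_density_def sound_speed_sq_def)

lemma sound_speed_sq_gas_density:
  assumes "a > 0" "gas_density a \<gamma> q z > 0"
  shows "sound_speed_sq a \<gamma> q z = a\<^sup>2 * gas_density a \<gamma> q z powr (\<gamma> - 1)"
proof (cases "\<gamma> = 1")
  case True
  then show ?thesis by (simp add: sound_speed_sq_def gas_density_def)
next
  case False
  then show ?thesis
    using assms gas_density_pos_iff[of a \<gamma> q z] by (simp add: gas_density_def powr_powr)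
qed

definition potential_flow_at :: "real \<Rightarrow> real \<Rightarrow> (real^2 \<Rightarrow> real) \<Rightarrow> real^2 \<Rightarrow> bool" where
  "potential_flow_at a \<gamma> \<phi> x \<longleftrightarrow>
    (let csq = sound_speed_sq a \<gamma> ((norm (grad \<phi> x))\<^sup>2) (\<phi> x) in
      csq * laplacian \<phi> x
        - (\<Sum>i\<in>UNIV. \<Sum>j\<in>UNIV. pd i \<phi> x * pd j \<phi> x * pd i (pd j \<phi>) x)
      = (norm (grad \<phi> x))\<^sup>2 - 2 * csq)"

text \<open>The pseudo-Mach number $L = |\nabla\varphi| / c$.\<close>

definition pseudo_Mach :: "real \<Rightarrow> real \<Rightarrow> (real^2 \<Rightarrow> real) \<Rightarrow> real^2 \<Rightarrow> real" where
  "pseudo_Mach a \<gamma> \<phi> x =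
    norm (grad \<phi> x) / sound_speed a \<gamma> ((norm (grad \<phi> x))\<^sup>2) (\<phi> x)"

definition attains_max_on :: "('a \<Rightarrow> real) \<Rightarrow> 'a set \<Rightarrow> bool" where
  "attains_max_on f S \<longleftrightarrow> (\<exists>x\<in>S. \<forall>y\<in>S. f y \<le> f x)"

end

theory Submission
  imports Defs
begin

text \<open>
  At a point, take the orthonormal frame $e \parallel \nabla\varphi$, $n \perp e$, and put
  $s = \varphi_{ee}$, $r = \varphi_{en}$, $t = \varphi_{nn}$, $M = L^2$,
  $m = \frac{\gamma-1}{2} M$, $k = 1 + m$. Differentiating $c^2 M = |\nabla\varphi|^2$ twice and
  $(\ast)$ once along $e$ eliminates the third derivatives of $\varphi$ from
  $E = c^2 ((1 - M) M_{ee} + M_{nn})$. At an interior maximum of $M > 0$ the first-order relations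
  give $ks = -m$ and $kr = 0$, and then $k E = 2 (2 - M)(2 - M + m) > 0$, which contradicts
  $E \le 0$. With the perturbation $b$ these relations hold up to errors of order $\delta / L$,
  so for $L$ bounded below $E$ stays above $2\delta$ when $\delta$ is small; for small $L$ the
  same holds without the first-order relations, since $(\ast)$ forces $s + t \approx -2$ and
  $E \approx 2 s^2 + 4 r^2 + 2 t^2$. On the other hand $E \le 2\delta$ at a maximum of $M + b$.
  Hence there is no maximum when $\delta < \delta_0$, and $L^2 \le 1 \le \delta / \delta_0$
  otherwise.
\<close>

section \<open>Directional derivatives\<close>

text \<open>Derivatives along arbitrary vectors are needed because the argument runs in a frame
  aligned with the gradient at one point. The value is meaningful only where \<open>f\<close> is
  differentiable.\<close>

definition dd :: "real^2 \<Rightarrow> (real^2 \<Rightarrow> real) \<Rightarrow> real^2 \<Rightarrow> real" where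
  "dd v f x = frechet_derivative f (at x) v"

lemma pd_eq_dd: "pd i = dd (axis i 1)"
  by (simp add: fun_eq_iff pd_def dd_def)

lemma dd_eq_pd:
  assumes "f differentiable (at x)"
  shows "dd v f x = v $ 1 * pd 1 f x + v $ 2 * pd 2 f x"
proof -
  interpret linear "frechet_derivative f (at x)"
    by (rule linear_frechet_derivative[OF assms])
  have "v = v $ 1 *\<^sub>R axis 1 1 + v $ 2 *\<^sub>R axis 2 1"
    by (simp add: vec_eq_iff forall_2 axis_def)
  then have "dd v f x = frechet_derivative f (at x) (v $ 1 *\<^sub>R axis 1 1 + v $ 2 *\<^sub>R axis 2 1)"
    by (simp add: dd_def)
  also have "\<dots> = v $ 1 * pd 1 f x + v $ 2 * pd 2 f x"
    by (simp add: add scale pd_def)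
  finally show ?thesis .
qed

lemma DERIV_line:
  assumes "f differentiable (at (x + t *\<^sub>R v))"
  shows "((\<lambda>t. f (x + t *\<^sub>R v)) has_real_derivative dd v f (x + t *\<^sub>R v)) (at t)"
proof -
  interpret linear "frechet_derivative f (at (x + t *\<^sub>R v))"
    by (rule linear_frechet_derivative[OF assms])
  have "((\<lambda>t. x + t *\<^sub>R v) has_derivative (\<lambda>h. h *\<^sub>R v)) (at t)"
    by (auto intro!: derivative_eq_intros)
  from has_derivative_compose[OF this] assms
  have "((\<lambda>t. f (x + t *\<^sub>R v)) has_derivative
      (\<lambda>h. frechet_derivative f (at (x + t *\<^sub>R v)) (h *\<^sub>R v))) (at t)"
    by (simp add: frechet_derivative_works)
  then show ?thesis
    by (simp add: has_field_derivative_def scale dd_def mult.commute[of _ "frechet_derivative _ _ _"])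
qed

lemma DERIV_dd:
  assumes "f differentiable (at x)"
  shows "((\<lambda>t. f (x + t *\<^sub>R v)) has_real_derivative dd v f x) (at 0)"
  using DERIV_line[of f x 0 v] assms by simp

text \<open>Turns one-variable differentiation rules into values of \<open>dd\<close>: near
  \<open>x\<close> the function is replaced by a formula \<open>g\<close>, of which only the
  restriction to the line through \<open>x\<close> has to be differentiated.\<close>

lemma dd_eqI:
  assumes "open S" "x \<in> S" and "f differentiable (at x)" and eq: "\<And>y. y \<in> S \<Longrightarrow> f y = g y"
    and g: "((\<lambda>t. g (x + t *\<^sub>R v)) has_real_derivative d) (at 0)"
  shows "dd v f x = d"
proof -
  have "open ((\<lambda>t::real. x + t *\<^sub>R v) -` S)"
    using \<open>open S\<close> by (intro open_vimage continuous_intros)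
  then have "((\<lambda>t. f (x + t *\<^sub>R v)) has_real_derivative d) (at 0)"
    using g \<open>x \<in> S\<close> eq by (elim has_field_derivative_transform_within_open) auto
  then show ?thesis
    using DERIV_dd[OF assms(3)] DERIV_unique by blast
qed

section \<open>Locality and linearity of the classes C^k\<close>

lemma differentiable_at_cong_open:
  assumes "open S" "x \<in> S" "\<And>y. y \<in> S \<Longrightarrow> f y = g y" "g differentiable (at x)"
  shows "f differentiable (at x)"
proof -
  obtain g' where "(g has_derivative g') (at x)"
    using assms(4) by (auto simp: differentiable_def)
  then have "(f has_derivative g') (at x)"
    by (rule has_derivative_transform_within_open[OF _ assms(1,2)]) (simp add: assms(3))
  then show ?thesis
    by (auto simp: differentiable_def)
qed

lemma dd_cong_open:
  assumes "open S" "x \<in> S" "\<And>y. y \<in> S \<Longrightarrow> f y = g y" "g differentiable (at x)"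
  shows "dd v f x = dd v g x"
  by (rule dd_eqI[OF assms(1,2) differentiable_at_cong_open[OF assms] assms(3) DERIV_dd[OF assms(4)]])

text \<open>On an open set the partial derivatives depend only on values inside the set, so
  agreement on \<open>S\<close> passes to them and induction on \<open>k\<close> applies.\<close>

lemma C_k_on_cong:
  assumes "open S" "\<And>y. y \<in> S \<Longrightarrow> f y = g y" "C_k_on k g S"
  shows "C_k_on k f S"
  using assms(2,3)
proof (induction k arbitrary: f g)
  case 0
  then show ?case by (simp cong: continuous_on_cong)
next
  case (Suc k)
  have d: "g differentiable (at x)" if "x \<in> S" for x
    using Suc.prems(2) that \<open>open S\<close> by (simp add: differentiable_on_def at_within_open[of _ S])
  have "f differentiable_on S"
    using differentiable_at_cong_open[OF \<open>open S\<close> _ Suc.prems(1) d] \<open>open S\<close>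
    by (simp add: differentiable_on_def at_within_open[of _ S])
  moreover have "C_k_on k (pd i f) S" for i
  proof (rule Suc.IH)
    show "pd i f y = pd i g y" if "y \<in> S" for y
      unfolding pd_eq_dd by (rule dd_cong_open[OF \<open>open S\<close> that Suc.prems(1) d[OF that]])
    show "C_k_on k (pd i g) S" using Suc.prems by simp
  qed
  ultimately show ?case by simp
qed

lemma C_k_on_linear_combination:
  assumes "open S" "C_k_on k f S" "C_k_on k g S"
  shows "C_k_on k (\<lambda>x. a * f x + b * g x) S"
  using assms(2,3)
proof (induction k arbitrary: f g)
  case 0
  then show ?case by (simp add: continuous_on_add continuous_on_mult_left)
next
  case (Suc k)
  have d: "f differentiable (at x)" "g differentiable (at x)" if "x \<in> S" for x
    using Suc.prems that \<open>open S\<close> by (auto simp: differentiable_on_def at_within_open[of _ S])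
  have "(\<lambda>x. a * f x + b * g x) differentiable_on S"
    using d \<open>open S\<close> by (simp add: differentiable_on_def at_within_open[of _ S])
  moreover have "C_k_on k (pd i (\<lambda>x. a * f x + b * g x)) S" for i
  proof (rule C_k_on_cong[OF \<open>open S\<close> _ Suc.IH])
    show "pd i (\<lambda>x. a * f x + b * g x) y = a * pd i f y + b * pd i g y" if "y \<in> S" for y
    proof -
      note df = DERIV_dd[OF d(1)[OF that], of "axis i 1"] and dg = DERIV_dd[OF d(2)[OF that], of "axis i 1"]
      show ?thesis unfolding pd_eq_dd
      proof (rule dd_eqI[OF \<open>open S\<close> that])
        show "(\<lambda>x. a * f x + b * g x) differentiable (at y)" using d[OF that] by simp
        show "DERIV (\<lambda>t. a * f (y + t *\<^sub>R axis i 1) + b * g (y + t *\<^sub>R axis i 1)) 0 :>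
            a * dd (axis i 1) f y + b * dd (axis i 1) g y"
          by (rule derivative_eq_intros df dg refl)+ simp
      qed simp
    qed
  qed (use Suc.prems in simp_all)
  ultimately show ?case by simp
qed

lemma C_k_on_differentiable_at:
  assumes "open S" "C_k_on (Suc k) f S" "x \<in> S"
  shows "f differentiable (at x)"
  using assms by (simp add: differentiable_on_def at_within_open[of _ S])

text \<open>A directional derivative is a combination of partial derivatives with constant
  coefficients, so differentiating along a fixed vector costs one order of regularity.\<close>

lemma C_k_on_dd:
  assumes "open S" "C_k_on (Suc k) f S"
  shows "C_k_on k (dd v f) S"
proof (rule C_k_on_cong[OF \<open>open S\<close>])
  show "dd v f y = v $ 1 * pd 1 f y + v $ 2 * pd 2 f y" if "y \<in> S" for y
    by (rule dd_eq_pd[OF C_k_on_differentiable_at[OF assms that]])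
  show "C_k_on k (\<lambda>y. v $ 1 * pd 1 f y + v $ 2 * pd 2 f y) S"
    using assms by (intro C_k_on_linear_combination) auto
qed

lemma dd_dd_eq_pd:
  assumes "open S" "C_k_on (Suc (Suc k)) f S" "x \<in> S"
  shows "dd v (dd w f) x =
    v $ 1 * w $ 1 * pd 1 (pd 1 f) x + v $ 1 * w $ 2 * pd 1 (pd 2 f) x
    + v $ 2 * w $ 1 * pd 2 (pd 1 f) x + v $ 2 * w $ 2 * pd 2 (pd 2 f) x"
proof -
  have d: "pd i f differentiable (at x)" for i
    by (rule C_k_on_differentiable_at[of S k, OF assms(1) _ assms(3)]) (use assms(2) in simp)
  have d1: "DERIV (\<lambda>t. pd i f (x + t *\<^sub>R v)) 0 :> v $ 1 * pd 1 (pd i f) x + v $ 2 * pd 2 (pd i f) x" for i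
    using DERIV_dd[OF d] dd_eq_pd[OF d] by metis
  show ?thesis
  proof (rule dd_eqI[OF \<open>open S\<close> \<open>x \<in> S\<close>])
    show "dd w f differentiable (at x)"
      by (rule C_k_on_differentiable_at[OF assms(1) C_k_on_dd[OF assms(1,2)] assms(3)])
    show "dd w f y = w $ 1 * pd 1 f y + w $ 2 * pd 2 f y" if "y \<in> S" for y
      by (rule dd_eq_pd[OF C_k_on_differentiable_at[OF assms(1,2) that]])
    show "DERIV (\<lambda>t. w $ 1 * pd 1 f (x + t *\<^sub>R v) + w $ 2 * pd 2 f (x + t *\<^sub>R v)) 0 :>
        v $ 1 * w $ 1 * pd 1 (pd 1 f) x + v $ 1 * w $ 2 * pd 1 (pd 2 f) x
        + v $ 2 * w $ 1 * pd 2 (pd 1 f) x + v $ 2 * w $ 2 * pd 2 (pd 2 f) x"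
      by (rule derivative_eq_intros d1 refl)+ (simp add: algebra_simps)
  qed
qed

text \<open>Both iterated derivatives are limits of the same second difference quotient.\<close>

lemma second_difference_mvt:
  assumes f: "\<And>y. dist y x < r \<Longrightarrow> f differentiable (at y)"
    and fv: "\<And>y. dist y x < r \<Longrightarrow> dd v f differentiable (at y)"
    and h: "0 < h" "h * (norm v + norm w) < r"
  shows "\<exists>z. dist z x \<le> h * (norm v + norm w) \<and>
    f (x + h *\<^sub>R v + h *\<^sub>R w) - f (x + h *\<^sub>R v) - f (x + h *\<^sub>R w) + f x = h\<^sup>2 * dd w (dd v f) z"
proof -
  have dist: "dist (x + s *\<^sub>R v + t *\<^sub>R w) x \<le> h * (norm v + norm w)"
    if "0 \<le> s" "s \<le> h" "0 \<le> t" "t \<le> h" for s t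
  proof -
    have "norm (s *\<^sub>R v + t *\<^sub>R w) \<le> s * norm v + t * norm w"
      using norm_triangle_ineq[of "s *\<^sub>R v" "t *\<^sub>R w"] that by simp
    also have "\<dots> \<le> h * norm v + h * norm w"
      using that by (intro add_mono mult_right_mono) auto
    finally show ?thesis by (simp add: dist_norm algebra_simps)
  qed
  note dist' = le_less_trans[OF dist h(2)]
  \<comment> \<open>The second difference is the increment over [0, h] of \<open>?F\<close>, a
    difference in direction \<open>w\<close> viewed as a function along \<open>v\<close>. One mean
    value theorem along \<open>v\<close> and one along \<open>w\<close> produce the intermediate
    point.\<close>
  let ?F = "\<lambda>s. f ((x + h *\<^sub>R w) + s *\<^sub>R v) - f (x + s *\<^sub>R v)"
  have "\<exists>s. 0 < s \<and> s < h \<and> ?F h - ?F 0 = (h - 0) * (dd v f (x + h *\<^sub>R w + s *\<^sub>R v) - dd v f (x + s *\<^sub>R v))"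
  proof (rule MVT2[OF h(1)])
    fix s assume s: "0 \<le> s" "s \<le> h"
    have "f differentiable (at (x + h *\<^sub>R w + s *\<^sub>R v))" "f differentiable (at (x + s *\<^sub>R v))"
      using dist'[of s h] dist'[of s 0] s h(1) by (auto intro!: f simp: add_ac)
    from this[THEN DERIV_line]
    show "DERIV ?F s :> dd v f (x + h *\<^sub>R w + s *\<^sub>R v) - dd v f (x + s *\<^sub>R v)"
      by (rule DERIV_diff)
  qed
  then obtain s where s: "0 < s" "s < h"
    and F: "?F h - ?F 0 = h * (dd v f (x + h *\<^sub>R w + s *\<^sub>R v) - dd v f (x + s *\<^sub>R v))" by auto
  let ?G = "\<lambda>t. dd v f ((x + s *\<^sub>R v) + t *\<^sub>R w)"
  have "\<exists>t. 0 < t \<and> t < h \<and> ?G h - ?G 0 = (h - 0) * dd w (dd v f) (x + s *\<^sub>R v + t *\<^sub>R w)"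
    by (rule MVT2[OF h(1)], rule DERIV_line, rule fv, rule dist') (use s in auto)
  then obtain t where t: "0 < t" "t < h"
    and G: "?G h - ?G 0 = h * dd w (dd v f) (x + s *\<^sub>R v + t *\<^sub>R w)" by auto
  show ?thesis
  proof (intro exI conjI)
    show "dist (x + s *\<^sub>R v + t *\<^sub>R w) x \<le> h * (norm v + norm w)" using s t by (intro dist) auto
    show "f (x + h *\<^sub>R v + h *\<^sub>R w) - f (x + h *\<^sub>R v) - f (x + h *\<^sub>R w) + f x
        = h\<^sup>2 * dd w (dd v f) (x + s *\<^sub>R v + t *\<^sub>R w)"
      using F G by (simp add: power2_eq_square algebra_simps)
  qed
qed

lemma dd_commute:
  assumes "open S" "x \<in> S" and C2: "C_k_on (Suc (Suc k)) f S"
  shows "dd w (dd v f) x = dd v (dd w f) x"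
proof (rule ccontr)
  assume "dd w (dd v f) x \<noteq> dd v (dd w f) x"
  \<comment> \<open>Half the gap between the two mixed derivatives: values closer than
    \<open>e\<close> to the respective ends of the gap cannot coincide.\<close>
  define e where "e = \<bar>dd w (dd v f) x - dd v (dd w f) x\<bar> / 2"
  have e: "e > 0" using \<open>_ \<noteq> _\<close> by (simp add: e_def)
  obtain r where r: "r > 0" "ball x r \<subseteq> S"
    using assms(1,2) openE by blast
  have cont: "isCont (dd a (dd b f)) x" for a b
  proof -
    have "C_k_on k (dd a (dd b f)) S" using C2 \<open>open S\<close> by (intro C_k_on_dd)
    then have "continuous_on S (dd a (dd b f))"
      by (cases k) (auto intro: differentiable_imp_continuous_on)
    then show ?thesis using assms(1,2) continuous_on_eq_continuous_at by blast
  qed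
  have "\<exists>d>0. \<forall>y. dist y x < d \<longrightarrow> dist (dd a (dd b f) y) (dd a (dd b f) x) < e" for a b
    using cont[of a b] e unfolding continuous_at_eps_delta by (simp add: dist_norm)
  then obtain d1 d2 where d1: "d1 > 0" "\<And>y. dist y x < d1 \<Longrightarrow> dist (dd w (dd v f) y) (dd w (dd v f) x) < e"
    and d2: "d2 > 0" "\<And>y. dist y x < d2 \<Longrightarrow> dist (dd v (dd w f) y) (dd v (dd w f) x) < e"
    by metis
  define d where "d = min r (min d1 d2)"
  \<comment> \<open>The 1 in the denominator covers \<open>v\<close> = \<open>w\<close> = 0; all
    points reached stay within distance \<open>d\<close> / 2 of \<open>x\<close>.\<close>
  define h where "h = d / (2 * (norm v + norm w + 1))"
  have "d > 0" using r d1 d2 by (simp add: d_def)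
  have N: "norm v + norm w + 1 > 0" by (smt (verit) norm_ge_zero)
  have h: "h > 0" using \<open>d > 0\<close> N by (simp add: h_def)
  have "h * (norm v + norm w) \<le> h * (norm v + norm w + 1)" using h by simp
  also have "\<dots> = d / 2" using N by (simp add: h_def field_simps)
  finally have hd: "h * (norm v + norm w) < d" using \<open>d > 0\<close> by simp
  have diff: "f differentiable (at y)" "dd a f differentiable (at y)" if "dist y x < d" for y a
  proof -
    have "y \<in> S" using r(2) that by (auto simp: d_def dist_commute)
    then show "f differentiable (at y)" "dd a f differentiable (at y)"
      using C_k_on_differentiable_at[OF assms(1)] C2 C_k_on_dd[OF assms(1) C2] by blast+
  qed
  obtain z1 where z1: "dist z1 x \<le> h * (norm v + norm w)"
    "f (x + h *\<^sub>R v + h *\<^sub>R w) - f (x + h *\<^sub>R v) - f (x + h *\<^sub>R w) + f x = h\<^sup>2 * dd w (dd v f) z1"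
    using second_difference_mvt[OF diff h hd] by blast
  obtain z2 where z2: "dist z2 x \<le> h * (norm w + norm v)"
    "f (x + h *\<^sub>R w + h *\<^sub>R v) - f (x + h *\<^sub>R w) - f (x + h *\<^sub>R v) + f x = h\<^sup>2 * dd v (dd w f) z2"
    using second_difference_mvt[where v = w and w = v, OF diff h] hd by (auto simp: add.commute)
  have "h\<^sup>2 * dd w (dd v f) z1 = h\<^sup>2 * dd v (dd w f) z2"
    using z1(2) z2(2) by (simp add: algebra_simps)
  then have "dd w (dd v f) z1 = dd v (dd w f) z2" using h by simp
  moreover have "dist (dd w (dd v f) z1) (dd w (dd v f) x) < e"
    using z1(1) hd by (intro d1) (auto simp: d_def)
  moreover have "dist (dd v (dd w f) z2) (dd v (dd w f) x) < e"
    using z2(1) hd by (intro d2) (auto simp: d_def add.commute)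
  ultimately show False by (simp add: e_def dist_real_def abs_if split: if_splits)
qed

section \<open>Derivative tests at an interior maximum\<close>

text \<open>Along the line through \<open>x\<close> the first claim is Fermat's rule. If the second
  derivative were positive, the first derivative, zero at \<open>x\<close>, would be positive just
  beyond it, and by the mean value theorem \<open>f\<close> would exceed its maximum.\<close>

lemma dd_at_max:
  assumes "open S" "x \<in> S" and f: "\<And>y. y \<in> S \<Longrightarrow> f differentiable (at y)"
    and f': "dd v f differentiable (at x)" and max: "\<And>y. y \<in> S \<Longrightarrow> f y \<le> f x"
  shows "dd v f x = 0" "dd v (dd v f) x \<le> 0"
proof -
  have "open ((\<lambda>t::real. x + t *\<^sub>R v) -` S)"
    using \<open>open S\<close> by (intro open_vimage continuous_intros)
  moreover have "0 \<in> (\<lambda>t::real. x + t *\<^sub>R v) -` S" using \<open>x \<in> S\<close> by simp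
  ultimately obtain d where d: "d > 0" "ball 0 d \<subseteq> (\<lambda>t::real. x + t *\<^sub>R v) -` S"
    by (rule openE)
  then have S: "x + t *\<^sub>R v \<in> S" if "\<bar>t\<bar> < d" for t
    using that by (auto simp: subset_eq)
  show z: "dd v f x = 0"
    by (rule DERIV_local_max[OF DERIV_dd[OF f[OF \<open>x \<in> S\<close>]] d(1)]) (use S max in auto)
  show "dd v (dd v f) x \<le> 0"
  proof (rule ccontr)
    assume "\<not> ?thesis"
    then obtain d' where d': "d' > 0" "\<And>h. 0 < h \<Longrightarrow> h < d' \<Longrightarrow> dd v f x < dd v f (x + h *\<^sub>R v)"
      using DERIV_pos_inc_right[OF DERIV_dd[OF f', of v]] by auto
    define h where "h = min d d' / 2"
    have h: "0 < h" "h < d" "h < d'" using d(1) d'(1) by (auto simp: h_def)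
    have "\<exists>t. 0 < t \<and> t < h \<and> f (x + h *\<^sub>R v) - f (x + 0 *\<^sub>R v) = (h - 0) * dd v f (x + t *\<^sub>R v)"
      by (rule MVT2[OF h(1)], rule DERIV_line, rule f, rule S) (use h in auto)
    then obtain t where t: "0 < t" "t < h" "f (x + h *\<^sub>R v) - f x = h * dd v f (x + t *\<^sub>R v)"
      by auto
    have "dd v f (x + t *\<^sub>R v) > 0" using d'(2)[of t] t h z by auto
    then have "f (x + h *\<^sub>R v) > f x" using t h by (smt (verit) mult_pos_pos)
    then show False using max[OF S[of h]] h by auto
  qed
qed

section \<open>The second-order form at a point\<close>

text \<open>Pure algebra at one point, with \<open>g\<close> = \<gamma> - 1 and \<open>L * c\<close>
  = |grad \<phi>|. \<open>T1\<close> and \<open>T2\<close> stand for \<phi>_eee and \<phi>_enn,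
  \<open>Ce\<close>, \<open>Cee\<close> and so on for derivatives of c^2, \<open>Me\<close>,
  \<open>Mee\<close> and so on for those of L^2. \<open>eq\<close> is the flow equation in the frame
  and \<open>eq_e\<close> its derivative along e.\<close>

lemma mach_second_order_identity:
  fixes c L g s r t T1 T2 C0 Ce Cn Cee Cnn Me Mn Mee Mnn :: real
  assumes c: "c > 0"
    and eq: "c\<^sup>2 * (s + t) - (L * c)\<^sup>2 * s = (L * c)\<^sup>2 - 2 * c\<^sup>2"
    and Ce: "Ce = - g * (L * c) * (1 + s)" and Cn: "Cn = - g * (L * c) * r"
    and Cee: "Cee = - g * (s + (s\<^sup>2 + r\<^sup>2 + L * c * T1))"
    and Cnn: "Cnn = - g * (t + (r\<^sup>2 + t\<^sup>2 + L * c * T2))"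
    and eq_e: "Ce * (s + t) + c\<^sup>2 * (T1 + T2) - 2 * (L * c) * s\<^sup>2 - (L * c)\<^sup>2 * T1 - 2 * (L * c) * r\<^sup>2
       = 2 * (L * c) * s - 2 * Ce"
    and Me: "Ce * L\<^sup>2 + c\<^sup>2 * Me = 2 * (L * c) * s"
    and Mn: "Cn * L\<^sup>2 + c\<^sup>2 * Mn = 2 * (L * c) * r"
    and Mee: "Cee * L\<^sup>2 + 2 * Ce * Me + c\<^sup>2 * Mee = 2 * (s\<^sup>2 + r\<^sup>2 + L * c * T1)"
    and Mnn: "Cnn * L\<^sup>2 + 2 * Cn * Mn + c\<^sup>2 * Mnn = 2 * (r\<^sup>2 + t\<^sup>2 + L * c * T2)"
    and m: "m = g * L\<^sup>2 / 2" and k: "k = 1 + m"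
  shows "(1 - L\<^sup>2) * s + t = L\<^sup>2 - 2"
    and "c * Me = 2 * L * (k * s + m)"
    and "c * Mn = 2 * L * k * r"
    and "c\<^sup>2 * ((1 - L\<^sup>2) * Mee + Mnn) =
      k * (2 * (1 + L\<^sup>2) * s\<^sup>2 + 2 * (2 + L\<^sup>2) * r\<^sup>2 + 2 * t\<^sup>2 + 4 * m * L\<^sup>2 * s * (1 + s) + 2 * L * (c * Me))
      + 2 * m * (L\<^sup>2 - 2) + 2 * g * L * ((1 - L\<^sup>2) * (c * Me) * (1 + s) + c * Mn * r)"
proof -
  show t: "(1 - L\<^sup>2) * s + t = L\<^sup>2 - 2"
  proof -
    have "c\<^sup>2 * ((1 - L\<^sup>2) * s + t) = c\<^sup>2 * (L\<^sup>2 - 2)" using eq by algebra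
    thus ?thesis using c by simp
  qed
  have gm: "g * L\<^sup>2 = 2 * m" using m by simp
  show me: "c * Me = 2 * L * (k * s + m)"
  proof -
    have "c * (c * Me) = c * (2 * L * (k * s + m))" using Me Ce gm k by algebra
    thus ?thesis using c by simp
  qed
  show mn: "c * Mn = 2 * L * k * r"
  proof -
    have "c * (c * Mn) = c * (2 * L * k * r)" using Mn Cn gm k by algebra
    thus ?thesis using c by simp
  qed
  \<comment> \<open>Third derivatives enter only through (1 - L^2) \<phi>_eee + \<phi>_enn, the
    combination that the differentiated flow equation determines.\<close>
  have T: "L * c * ((1 - L\<^sup>2) * T1 + T2) = 2 * L\<^sup>2 * (s\<^sup>2 + r\<^sup>2) + 2 * m * L\<^sup>2 * s * (1 + s) + L * (c * Me)"
  proof -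
    have "c * (c * ((1 - L\<^sup>2) * T1 + T2)) = c * (2 * L * s + 2 * g * L * (1+s) + g * L * (1+s) * (s+t) + 2 * L * (s\<^sup>2+r\<^sup>2))"
      using eq_e Ce by algebra
    hence "c * ((1 - L\<^sup>2) * T1 + T2) = 2 * L * s + 2 * g * L * (1+s) + g * L * (1+s) * (s+t) + 2 * L * (s\<^sup>2+r\<^sup>2)"
      using c by simp
    thus ?thesis using me gm k t by algebra
  qed
  \<comment> \<open>The second derivatives of |grad \<phi>|^2 enter once directly and once through
    c^2, which gives the common factor 2 + \<open>g\<close> L^2 = 2 \<open>k\<close>.\<close>
  have "c\<^sup>2 * ((1 - L\<^sup>2) * Mee + Mnn) = 2 * k * ((1 - L\<^sup>2) * (s\<^sup>2 + r\<^sup>2) + (r\<^sup>2 + t\<^sup>2) + L * c * ((1 - L\<^sup>2) * T1 + T2))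
     + 2 * m * ((1 - L\<^sup>2) * s + t) - 2 * (1 - L\<^sup>2) * Ce * Me - 2 * Cn * Mn"
    using Mee Mnn Cee Cnn gm k by algebra
  also have "\<dots> =  k * (2 * (1 + L\<^sup>2) * s\<^sup>2 + 2 * (2 + L\<^sup>2) * r\<^sup>2 + 2 * t\<^sup>2 + 4 * m * L\<^sup>2 * s * (1 + s) + 2 * L * (c * Me))
      + 2 * m * (L\<^sup>2 - 2) + 2 * g * L * ((1 - L\<^sup>2) * (c * Me) * (1 + s) + c * Mn * r)"
    unfolding T t Ce Cn by (simp add: algebra_simps)
  finally show "c\<^sup>2 * ((1 - L\<^sup>2) * Mee + Mnn) = \<dots>" .
qed

section \<open>Lower bounds for the second-order form\<close>

text \<open>This is the form at a critical point of L^2, where the terms with first derivatives of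
  L^2 have dropped out; the lower bound on \<open>m\<close> encodes \<gamma> \<ge> -1. Multiplying
  by \<open>k\<close> lets \<open>k * s\<close> and \<open>k * r\<close> be replaced by their known
  values.\<close>

lemma second_order_form_pos:
  fixes L m k s t r :: real
  assumes "0 < L" "L \<le> 1" "m \<ge> - L\<^sup>2" "k = 1 + m"
    and t: "(1 - L\<^sup>2) * s + t = L\<^sup>2 - 2" and s: "k * s + m = 0" and r: "k * r = 0"
  shows "k * (2 * (1 + L\<^sup>2) * s\<^sup>2 + 2 * (2 + L\<^sup>2) * r\<^sup>2 + 2 * t\<^sup>2 + 4 * m * L\<^sup>2 * s * (1 + s))
      + 2 * m * (L\<^sup>2 - 2) > 0" (is "?E > 0")
proof -
  have L2: "L\<^sup>2 \<le> 1" using assms by (simp add: power_le_one)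
  \<comment> \<open>For \<open>k\<close> = 0 the first-order relation would give \<open>m\<close> =
    0, but \<open>k\<close> = 1 + \<open>m\<close> gives \<open>m\<close> = -1. This excludes in
    particular L = 1 for \<gamma> = -1, where \<open>k\<close> vanishes.\<close>
  have "k \<noteq> 0" using s assms by auto
  hence kp: "k > 0" using L2 assms by auto
  have "k * ?E = 2 * (2 - L\<^sup>2) * (2 - L\<^sup>2 + m)"
    using t s r \<open>k = 1 + m\<close> \<open>k \<noteq> 0\<close> by algebra
  \<comment> \<open>The last factor is (1 - L^2) + \<open>k\<close>.\<close>
  moreover have "2 * (2 - L\<^sup>2) * (2 - L\<^sup>2 + m) > 0" using L2 kp \<open>k = 1 + m\<close> by simp
  ultimately show ?thesis using kp by (metis zero_less_mult_pos)
qed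

text \<open>\<open>B1\<close> and \<open>B2\<close> stand for c times the first derivatives of L^2.
  For small L they say little about \<open>s\<close> and \<open>r\<close>, so only their size is
  used: the flow equation keeps s^2 + t^2 away from 0, and 2 s^2 + 4 r^2 + 2 t^2 dominates the
  remaining terms.\<close>

lemma second_order_form_gt_small_mach:
  fixes g L s r t B1 B2 d :: real
  assumes L: "0 \<le> L" "L\<^sup>2 \<le> 1 / 4" "\<bar>g\<bar> * L\<^sup>2 \<le> 1 / 20"
    and d: "d \<le> 1 / 20" "\<bar>g\<bar> * d \<le> 1 / 20" and B: "\<bar>B1\<bar> \<le> d" "\<bar>B2\<bar> \<le> d"
    and m: "m = g * L\<^sup>2 / 2" and k: "k = 1 + m" and t: "(1 - L\<^sup>2) * s + t = L\<^sup>2 - 2"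
  shows "k * (2 * (1 + L\<^sup>2) * s\<^sup>2 + 2 * (2 + L\<^sup>2) * r\<^sup>2 + 2 * t\<^sup>2 + 4 * m * L\<^sup>2 * s * (1 + s) + 2 * L * B1)
      + 2 * m * (L\<^sup>2 - 2) + 2 * g * L * ((1 - L\<^sup>2) * B1 * (1 + s) + B2 * r) > 2 * d"
proof -
  define M where "M = L\<^sup>2"
  have M: "0 \<le> M" "M \<le> 1/4" using L by (auto simp: M_def)
  have L1: "L \<le> 1" using L(1,2) by (intro power2_le_imp_le[of L 1]) auto
  have "\<bar>m\<bar> = \<bar>g\<bar> * L\<^sup>2 / 2" unfolding m by (simp add: abs_mult)
  hence m1: "\<bar>m\<bar> \<le> 1/40" using L(3) by linarith
  have bound: "\<bar>x * y\<bar> \<le> a * b" if "\<bar>x\<bar> \<le> a" "\<bar>y\<bar> \<le> b" for x y a b :: real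
    using that unfolding abs_mult by (auto intro!: mult_mono order_trans[OF abs_ge_zero])
  \<comment> \<open>Lets terms linear in \<open>s\<close> and \<open>r\<close> be absorbed into the
    quadratic ones.\<close>
  have abs_le: "\<bar>x\<bar> \<le> 1/2 + x\<^sup>2 / 2" for x :: real
    using zero_le_power2[of "\<bar>x\<bar> - 1"] by (simp add: power2_eq_square algebra_simps)
  \<comment> \<open>|s| + |t| is at least 2 - L^2 \<ge> 7/4, and (7/4)^2 / 2 = 49/32 exceeds
    3/2.\<close>
  have st: "s\<^sup>2 + t\<^sup>2 \<ge> 3/2"
  proof -
    have "\<bar>(1 - M) * s\<bar> \<le> 1 * \<bar>s\<bar>" using M by (intro bound) auto
    hence "7/4 \<le> \<bar>s\<bar> + \<bar>t\<bar>" using t M unfolding M_def[symmetric] by linarith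
    hence "(7/4)\<^sup>2 \<le> (\<bar>s\<bar> + \<bar>t\<bar>)\<^sup>2" by (intro power_mono) auto
    moreover have "(\<bar>s\<bar> + \<bar>t\<bar>)\<^sup>2 \<le> 2 * (s\<^sup>2 + t\<^sup>2)"
      using zero_le_power2[of "\<bar>s\<bar> - \<bar>t\<bar>"] by (simp add: power2_eq_square algebra_simps)
    ultimately show ?thesis by (simp add: power2_eq_square)
  qed
  let ?A = "2 * (1 + M) * s\<^sup>2 + 2 * (2 + M) * r\<^sup>2 + 2 * t\<^sup>2 + 4 * m * M * s * (1 + s) + 2 * L * B1"
  have "\<bar>s * (1 + s)\<bar> \<le> 1 + 2 * s\<^sup>2"
    using abs_le[of s] abs_triangle_ineq[of s "s\<^sup>2"]
    by (simp add: power2_eq_square algebra_simps)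
  hence "\<bar>(4 * m * M) * (s * (1 + s))\<bar> \<le> (4 * (1/40) * (1/4)) * (1 + 2 * s\<^sup>2)"
    using M m1 by (intro bound) auto
  hence a1: "4 * m * M * s * (1 + s) \<ge> - (1 + 2 * s\<^sup>2) / 40"
    unfolding mult.assoc by argo
  have "\<bar>L * B1\<bar> \<le> 1 * d" using L L1 B by (intro bound) auto
  hence a2: "2 * L * B1 \<ge> - 1/10" using d by simp
  have a3: "2 * (1 + M) * s\<^sup>2 \<ge> 2 * s\<^sup>2" "2 * (2 + M) * r\<^sup>2 \<ge> 4 * r\<^sup>2"
    using M by (auto intro!: mult_right_mono)
  have A: "?A \<ge> (39/20) * (s\<^sup>2 + t\<^sup>2) + 4 * r\<^sup>2 - 1/8"
    using a1 a2 a3 zero_le_power2[of t] zero_le_power2[of s] by argo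
  have "k \<ge> 39/40" using k m1 by linarith
  hence "k * ?A \<ge> (39/40) * ?A" using A st zero_le_power2[of r] by (intro mult_right_mono) argo+
  hence e1: "k * ?A \<ge> (39/40) * ((39/20) * (s\<^sup>2 + t\<^sup>2) + 4 * r\<^sup>2 - 1/8)" using A by argo
  have "\<bar>m * (M - 2)\<bar> \<le> (1/40) * 2" using m1 M by (intro bound) auto
  hence e2: "2 * m * (M - 2) \<ge> - 1/10" by simp
  have gB: "\<bar>g * B1\<bar> \<le> 1/20" "\<bar>g * B2\<bar> \<le> 1/20"
    using order_trans[OF mult_left_mono[OF B(1) abs_ge_zero] d(2)]
      order_trans[OF mult_left_mono[OF B(2) abs_ge_zero] d(2)] unfolding abs_mult by blast+
  have "\<bar>1 + s\<bar> \<le> 3/2 + s\<^sup>2/2" "\<bar>r\<bar> \<le> 1/2 + r\<^sup>2/2" using abs_le[of s] abs_le[of r] by linarith+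
  hence "\<bar>(L * (1 - M)) * ((g * B1) * (1 + s))\<bar> \<le> (1 * 1) * ((1/20) * (3/2 + s\<^sup>2/2))"
    "\<bar>L * ((g * B2) * r)\<bar> \<le> 1 * ((1/20) * (1/2 + r\<^sup>2/2))"
    using L L1 M gB by (intro bound; simp)+
  moreover have "2 * g * L * ((1 - M) * B1 * (1 + s) + B2 * r)
      = 2 * ((L * (1 - M)) * ((g * B1) * (1 + s))) + 2 * (L * ((g * B2) * r))"
    by (simp add: algebra_simps)
  ultimately have e3: "2 * g * L * ((1 - M) * B1 * (1 + s) + B2 * r) \<ge> - (2 + s\<^sup>2/2 + r\<^sup>2/2) / 10"
    by argo
  \<comment> \<open>After all losses the coefficients of s^2, t^2 and r^2 stay positive, and s^2 +
    t^2 \<ge> 3/2 leaves more than 2 on the left, against 2 \<open>d\<close> \<le> 1/10.\<close>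
  show ?thesis using e1 e2 e3 st zero_le_power2[of r] zero_le_power2[of t] d(1)
    unfolding M_def[symmetric] by argo
qed

lemma continuous_on_unit_bounded:
  fixes f :: "real \<Rightarrow> real"
  assumes "continuous_on {0..1} f"
  obtains B where "\<And>x. 0 \<le> x \<Longrightarrow> x \<le> 1 \<Longrightarrow> \<bar>f x\<bar> \<le> B"
proof -
  have "bounded (f ` {0..1})"
    using assms by (intro compact_imp_bounded compact_continuous_image) auto
  then obtain B where "\<forall>x\<in>{0..1}. \<bar>f x\<bar> \<le> B" by (auto simp: bounded_iff)
  then show ?thesis by (intro that[of B]) auto
qed

text \<open>The strict bound \<open>g\<close> > -2 keeps \<open>k\<close> uniformly positive for L
  in [0, 1], so one threshold \<open>d0\<close> can be chosen from \<open>g\<close> alone. For L not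
  small, the bounds on \<open>B1\<close> and \<open>B2\<close> force \<open>s\<close> close to
  -\<open>m\<close> / \<open>k\<close> and \<open>r\<close> close to 0, where the form is at least
  2.\<close>

lemma second_order_form_gt:
  fixes g :: real
  assumes g: "g > -2"
  obtains d0 where "d0 > 0" "\<And>d L s r t B1 B2 m k :: real. d < d0 \<Longrightarrow> 0 \<le> L \<Longrightarrow> L \<le> 1 \<Longrightarrow>
     \<bar>B1\<bar> \<le> d \<Longrightarrow> \<bar>B2\<bar> \<le> d \<Longrightarrow> m = g * L\<^sup>2 / 2 \<Longrightarrow> k = 1 + m \<Longrightarrow> (1 - L\<^sup>2) * s + t = L\<^sup>2 - 2 \<Longrightarrow>
     B1 = 2 * L * (k * s + m) \<Longrightarrow> B2 = 2 * L * k * r \<Longrightarrow>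
     k * (2 * (1 + L\<^sup>2) * s\<^sup>2 + 2 * (2 + L\<^sup>2) * r\<^sup>2 + 2 * t\<^sup>2 + 4 * m * L\<^sup>2 * s * (1 + s) + 2 * L * B1)
      + 2 * m * (L\<^sup>2 - 2) + 2 * g * L * ((1 - L\<^sup>2) * B1 * (1 + s) + B2 * r) > 2 * d"
proof -
  define mm where "mm M = g * M / 2" for M
  txt \<open>Coefficients of the second-order form in the deviation $y$ of $s$ from $-m/k$ and in $r$.\<close>
  define X where "X M = - 4*(1+M)*mm M - 4*(M-2-mm M)*(1-M) + 4*mm M*M*(1 + mm M-2*mm M) 
     + 4*M*(1 + mm M)^2 + 8*mm M*(1-M)" for M
  define Y where "Y M = (1 + mm M) * (2*(1+M)+2*(1-M)\<^sup>2+4*mm M*M)+8*mm M*(1 + mm M)*(1-M)" for M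
  define Z where "Z M = (1 + mm M) * (2*(2+M)+8*mm M)" for M
  have "continuous_on {0..1} X" "continuous_on {0..1} Y" "continuous_on {0..1} Z"
    unfolding X_def Y_def Z_def mm_def by (intro continuous_intros; simp)+
  then obtain BX BY BZ where BX: "\<And>M. 0 \<le> M \<Longrightarrow> M \<le> 1 \<Longrightarrow> \<bar>X M\<bar> \<le> BX"
    and BY: "\<And>M. 0 \<le> M \<Longrightarrow> M \<le> 1 \<Longrightarrow> \<bar>Y M\<bar> \<le> BY" and BZ: "\<And>M. 0 \<le> M \<Longrightarrow> M \<le> 1 \<Longrightarrow> \<bar>Z M\<bar> \<le> BZ"
    using continuous_on_unit_bounded by (metis (no_types, lifting))
  define B where "B = BX + BY + BZ + 1"
  have B0: "BX \<ge> 0" "BY \<ge> 0" "BZ \<ge> 0" using BX[of 0] BY[of 0] BZ[of 0] by auto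
  \<comment> \<open>\<open>L1\<close> meets the demands of the small-L estimate, \<open>k0\<close>
    is the minimum of 1 + \<open>g\<close> M / 2 over M in [0, 1], and \<open>h\<close> is a radius
    within which the deviation terms total at most 1. The bounds in \<open>d0\<close> serve the
    small-L estimate, 2 \<open>d\<close> < 1, and the control of \<open>s\<close> and
    \<open>r\<close> by \<open>h\<close>.\<close>
  define L1 where "L1 = min (1/2) (1 / (20 * (\<bar>g\<bar> + 1)))"
  define k0 where "k0 = min 1 (1 + g / 2)"
  define h where "h = min 1 (1 / B)"
  define d0 where "d0 = min (1 / (20 * (\<bar>g\<bar> + 1))) (min (1/2) (2 * L1 * k0 * h))"
  have Bp: "B > 0" using B0 by (simp add: B_def)
  have pos: "L1 > 0" "k0 > 0" "h > 0" using Bp g by (auto simp: L1_def k0_def h_def)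
  have "d0 > 0" using pos by (simp add: d0_def)
  moreover have "k * (2 * (1 + L\<^sup>2) * s\<^sup>2 + 2 * (2 + L\<^sup>2) * r\<^sup>2 + 2 * t\<^sup>2 + 4 * m * L\<^sup>2 * s * (1 + s) + 2 * L * B1)
      + 2 * m * (L\<^sup>2 - 2) + 2 * g * L * ((1 - L\<^sup>2) * B1 * (1 + s) + B2 * r) > 2 * d" (is "?E > _")
    if d: "d < d0" and L: "0 \<le> L" "L \<le> 1" and B12: "\<bar>B1\<bar> \<le> d" "\<bar>B2\<bar> \<le> d" and m: "m = g * L\<^sup>2 / 2"
    and k: "k = 1 + m" and t: "(1 - L\<^sup>2) * s + t = L\<^sup>2 - 2"
    and b: "B1 = 2 * L * (k * s + m)" "B2 = 2 * L * k * r" for d L s r t B1 B2 m k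
  proof (cases "L \<le> L1")
    case True
    have g1: "\<bar>g\<bar> * (1 / (20 * (\<bar>g\<bar> + 1))) \<le> 1/20" "1 / (20 * (\<bar>g\<bar> + 1)) \<le> 1/20"
      by (auto simp: divide_simps)
    have LL: "L * L \<le> L * L1" "L * L1 \<le> 1 * L1" using L True pos by (intro mult_mono; auto)+
    have L2: "L\<^sup>2 \<le> L1\<^sup>2" using L True by (intro power_mono) auto
    also have "L1\<^sup>2 \<le> (1/2)\<^sup>2" using pos by (intro power_mono) (auto simp: L1_def)
    finally have "L\<^sup>2 \<le> 1/4" by (simp add: power2_eq_square)
    moreover have "\<bar>g\<bar> * L\<^sup>2 \<le> \<bar>g\<bar> * (1 / (20 * (\<bar>g\<bar> + 1)))"
      using LL by (intro mult_left_mono) (auto simp: L1_def power2_eq_square)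
    moreover have "\<bar>g\<bar> * d \<le> \<bar>g\<bar> * (1 / (20 * (\<bar>g\<bar> + 1)))"
      using d by (intro mult_left_mono) (auto simp: d0_def)
    moreover have "d \<le> 1 / 20" using d g1(2) unfolding d0_def by linarith
    ultimately show ?thesis
      using g1 by (intro second_order_form_gt_small_mach[OF L(1) _ _ _ _ B12 m k t]) linarith+
  next
    case False
    define M where "M = L\<^sup>2"
    have M: "0 \<le> M" "M \<le> 1" using L by (auto simp: M_def power_le_one)
    have kk: "k \<ge> k0"
    proof -
      have "g * M \<ge> min 0 g" using M by (cases "g \<ge> 0") (auto simp: mult_le_cancel_left1 min_def)
      thus ?thesis by (auto simp: k m k0_def M_def[symmetric] min_def split: if_splits)
    qed
    hence kp: "k > 0" using pos by linarith
    \<comment> \<open>Measured from the zero of \<open>k * s + m\<close>, the deviation makes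
      \<open>B1\<close> = 2 L \<open>k\<close> \<open>y\<close>, of the same shape as
      \<open>B2\<close> = 2 L \<open>k\<close> \<open>r\<close>.\<close>
    define y where "y = s + m / k"
    have b1: "B1 = 2 * L * k * y" using b kp by (simp add: y_def field_simps)
    \<comment> \<open>Here 2 L \<open>k\<close> exceeds 2 \<open>L1\<close> \<open>k0\<close>, so
      \<open>d\<close> < 2 \<open>L1\<close> \<open>k0\<close> \<open>h\<close> caps the
      deviation.\<close>
    have small: "\<bar>x\<bar> \<le> h" if "\<bar>2 * L * k * x\<bar> \<le> d" for x
    proof (rule ccontr)
      assume x: "\<not> \<bar>x\<bar> \<le> h"
      have "2 * L1 * k0 * h \<le> 2 * L * k * \<bar>x\<bar>"
        using x False pos kk L kp by (intro mult_mono) auto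
      also have "\<dots> \<le> d" using that L kp by (simp add: abs_mult)
      also have "\<dots> < 2 * L1 * k0 * h" using d by (simp add: d0_def)
      finally show False by simp
    qed
    have y: "\<bar>y\<bar> \<le> h" and r: "\<bar>r\<bar> \<le> h" using small B12 b1 b(2) by auto
    have sq: "x\<^sup>2 \<le> h" if "\<bar>x\<bar> \<le> h" for x
    proof -
      have "h \<le> 1" by (simp add: h_def)
      have "x\<^sup>2 = \<bar>x\<bar> * \<bar>x\<bar>" by (simp add: power2_eq_square)
      also have "\<dots> \<le> h * 1" using that \<open>h \<le> 1\<close> by (intro mult_mono) auto
      finally show ?thesis by simp
    qed
    have mm: "mm M = m" by (simp add: mm_def m M_def)
    define s0 where "s0 = - m / k"
    have s0: "k * s0 = - m" "s = s0 + y" using kp by (auto simp: s0_def y_def)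
    define t0 where "t0 = M - 2 - (1 - M) * s0"
    have tt: "t = t0 - (1 - M) * y" using t unfolding t0_def s0(2) M_def by (simp add: algebra_simps)
    have gM: "g * M = 2 * m" by (simp add: m M_def)
    have kt0: "k * t0 = M - 2 - m" unfolding t0_def using s0(1) k by algebra
    \<comment> \<open>The relation \<open>g\<close> L^2 = 2 \<open>m\<close> removes the odd powers
      of L, after which every coefficient is a polynomial in M.\<close>
    have LB: "L * B1 = 2 * M * k * y" "g * L * B1 = 4 * m * k * y" "g * L * B2 = 4 * m * k * r"
      using gM unfolding M_def b1 b(2) by - algebra+
    \<comment> \<open>The form at \<open>s0\<close>, \<open>t0\<close> and \<open>r\<close> = 0, the
      quantity already evaluated in \<open>second_order_form_pos\<close>.\<close>
    let ?F = "k * (2 * (1 + M) * s0\<^sup>2 + 2 * t0\<^sup>2 + 4 * m * M * s0 * (1 + s0)) + 2 * m * (M - 2)"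
    have "k * ?F = 2 * (1 + M) * (k * s0)\<^sup>2 + 2 * (k * t0)\<^sup>2 + 4 * m * M * (k * s0) * (k + k * s0) + k * 2 * m * (M - 2)"
      by (simp add: power2_eq_square algebra_simps)
    also have "\<dots> = 2 * (2 - M) * (2 - M + m)"
      unfolding s0(1) kt0 unfolding k by (simp add: power2_eq_square algebra_simps)
    finally have E0: "k * ?F = 2 * (2 - M) * (2 - M + m)" .
    have "?E = k * (2 * (1 + M) * s\<^sup>2 + 2 * (2 + M) * r\<^sup>2 + 2 * t\<^sup>2 + 4 * m * M * s * (1 + s) + 2 * (L * B1))
      + 2 * m * (M - 2) + 2 * ((1 - M) * (g * L * B1) * (1 + s) + g * L * B2 * r)"
      by (simp add: M_def algebra_simps)
    also have "\<dots> = ?F + (4 * (1 + M) * (k * s0) - 4 * (k * t0) * (1 - M) + 4 * m * M * (k + 2 * (k * s0)) 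
         + 4 * M * k\<^sup>2 + 8 * m * (1 - M) * (k + k * s0)) * y + Y M * y\<^sup>2 + Z M * r\<^sup>2"
      unfolding LB s0(2) tt Y_def Z_def mm k[symmetric] by (simp add: power2_eq_square algebra_simps)
    also have "\<dots> = ?F + (X M * y + Y M * y\<^sup>2 + Z M * r\<^sup>2)"
      unfolding s0(1) kt0 X_def mm by (simp add: k algebra_simps)
    finally have EE: "k * ?E = 2 * (2 - M) * (2 - M + m) + k * (X M * y + Y M * y\<^sup>2 + Z M * r\<^sup>2)"
      using E0 by (metis distrib_left)
    \<comment> \<open>Since 2 - M \<ge> 1, the main term is at least 2 \<open>k\<close>; the factor
      \<open>k\<close> then cancels throughout, so no power of 1 / \<open>k\<close> enters the
      estimate.\<close>
    have "2 - M + m = (1 - M) + k" by (simp add: k)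
    hence "2 * (2 - M) * (2 - M + m) \<ge> 2 * 1 * k" using M kp by (intro mult_mono) auto
    hence "k * ?E \<ge> k * (2 + (X M * y + Y M * y\<^sup>2 + Z M * r\<^sup>2))" unfolding EE by (simp add: algebra_simps)
    hence E: "?E \<ge> 2 + (X M * y + Y M * y\<^sup>2 + Z M * r\<^sup>2)" using kp by simp
    have "\<bar>X M * y\<bar> \<le> BX * h" "\<bar>Y M * y\<^sup>2\<bar> \<le> BY * h" "\<bar>Z M * r\<^sup>2\<bar> \<le> BZ * h"
      using BX BY BZ M y r sq[of y] sq[of r] B0 unfolding abs_mult by (auto intro!: mult_mono)
    moreover have "(BX + BY + BZ) * h \<le> B * h" using pos by (simp add: B_def)
    moreover have "B * h \<le> B * (1 / B)" using Bp by (intro mult_left_mono) (auto simp: h_def)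
    moreover have "B * (1 / B) = 1" using Bp by simp
    ultimately have "?E \<ge> 1" using E by (simp add: algebra_simps)
    moreover have "2 * d < 1" using d by (simp add: d0_def)
    ultimately show ?thesis by linarith
  qed
  ultimately show ?thesis using that by blast
qed

section \<open>Maximum principles for the pseudo-Mach number\<close>

lemma adapted_frame:
  fixes p :: "real^2"
  obtains e n :: "real^2" where "n $ 1 = - e $ 2" "n $ 2 = e $ 1" "(e $ 1)\<^sup>2 + (e $ 2)\<^sup>2 = 1"
    "e $ 1 * p $ 1 + e $ 2 * p $ 2 = norm p" "n $ 1 * p $ 1 + n $ 2 * p $ 2 = 0"
proof -
  \<comment> \<open>For \<open>p\<close> = 0 any unit vector meets the requirements.\<close>
  define e where "e = (if p = 0 then axis 1 1 else p /\<^sub>R norm p)"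
  define n :: "real^2" where "n = (\<chi> i. if i = 1 then - e $ 2 else e $ 1)"
  have np: "norm p ^ 2 = (p $ 1)\<^sup>2 + (p $ 2)\<^sup>2"
    by (simp add: norm_vec_def L2_set_def sum_2)
  have p: "p = norm p *\<^sub>R e" by (simp add: e_def)
  then have p': "p $ i = norm p * e $ i" for i by (metis vector_scaleR_component real_scaleR_def)
  have "norm e = 1" by (simp add: e_def)
  then have e: "(e $ 1)\<^sup>2 + (e $ 2)\<^sup>2 = 1"
    by (simp add: norm_vec_def L2_set_def sum_2)
  have n: "n $ 1 = - e $ 2" "n $ 2 = e $ 1" by (auto simp: n_def)
  have "e $ 1 * p $ 1 + e $ 2 * p $ 2 = norm p * ((e $ 1)\<^sup>2 + (e $ 2)\<^sup>2)"
    unfolding p' by (simp add: power2_eq_square algebra_simps)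
  moreover have "n $ 1 * p $ 1 + n $ 2 * p $ 2 = 0"
    unfolding p' n by simp
  ultimately show ?thesis using e n that by simp
qed

lemma norm_grad_sq: "(norm (grad f x))\<^sup>2 = (pd 1 f x)\<^sup>2 + (pd 2 f x)\<^sup>2"
  by (simp add: norm_vec_def L2_set_def sum_2 grad_def)

text \<open>The frame is chosen at \<open>x\<close> and then kept as two constant vectors: \<phi>_n
  vanishes at \<open>x\<close> but need not vanish nearby, so its derivatives contribute. Working
  with L^2 instead of L avoids the norm, which may fail to be differentiable where the gradient
  vanishes.\<close>

lemma mach_second_order_at_point:
  fixes a \<gamma> L c m k :: real and \<phi> :: "real^2 \<Rightarrow> real"
  defines "csq \<equiv> \<lambda>y. sound_speed_sq a \<gamma> ((norm (grad \<phi> y))\<^sup>2) (\<phi> y)"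
  defines "M \<equiv> \<lambda>y. (pseudo_Mach a \<gamma> \<phi> y)\<^sup>2"
  assumes S: "open S" and x: "x \<in> S" and C3: "C_k_on 3 \<phi> S"
    and flow: "\<And>y. y \<in> S \<Longrightarrow> potential_flow_at a \<gamma> \<phi> y"
    and pos: "\<And>y. y \<in> S \<Longrightarrow> csq y > 0"
    and L: "L = pseudo_Mach a \<gamma> \<phi> x" and c: "c = sqrt (csq x)"
    and m: "m = (\<gamma> - 1) * L\<^sup>2 / 2" and k: "k = 1 + m"
  obtains e n :: "real^2" and s r t :: real where
    "(e $ 1)\<^sup>2 + (e $ 2)\<^sup>2 = 1" "(n $ 1)\<^sup>2 + (n $ 2)\<^sup>2 = 1"
    "\<And>y. y \<in> S \<Longrightarrow> M differentiable (at y)"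
    "\<And>v y. y \<in> S \<Longrightarrow> dd v M differentiable (at y)"
    "(1 - L\<^sup>2) * s + t = L\<^sup>2 - 2"
    "c * dd e M x = 2 * L * (k * s + m)"
    "c * dd n M x = 2 * L * k * r"
    "c\<^sup>2 * ((1 - L\<^sup>2) * dd e (dd e M) x + dd n (dd n M) x) =
      k * (2 * (1 + L\<^sup>2) * s\<^sup>2 + 2 * (2 + L\<^sup>2) * r\<^sup>2 + 2 * t\<^sup>2 + 4 * m * L\<^sup>2 * s * (1 + s)
        + 2 * L * (c * dd e M x)) + 2 * m * (L\<^sup>2 - 2)
      + 2 * (\<gamma> - 1) * L * ((1 - L\<^sup>2) * (c * dd e M x) * (1 + s) + c * dd n M x * r)"
proof -
  obtain e n :: "real^2" where n: "n $ 1 = - e $ 2" "n $ 2 = e $ 1" and e: "(e $ 1)\<^sup>2 + (e $ 2)\<^sup>2 = 1"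
    and grad: "e $ 1 * grad \<phi> x $ 1 + e $ 2 * grad \<phi> x $ 2 = norm (grad \<phi> x)"
    "n $ 1 * grad \<phi> x $ 1 + n $ 2 * grad \<phi> x $ 2 = 0"
    by (rule adapted_frame[of "grad \<phi> x"]) blast
  define g where "g = \<gamma> - 1"
  \<comment> \<open>One affine formula for both gas laws: for \<gamma> = 1 the factor
    \<open>g\<close> is 0 and \<open>K\<close> is a^2, otherwise \<open>K\<close> is 0.\<close>
  define K where "K = (if \<gamma> = 1 then a\<^sup>2 else 0)"
  define P N where "P = dd e \<phi>" and "N = dd n \<phi>"
  define q where "q y = (P y)\<^sup>2 + (N y)\<^sup>2" for y
  define C where "C y = K - g * (\<phi> y + q y / 2)" for y
  have C\<phi>: "C_k_on (Suc (Suc (Suc 0))) \<phi> S" using C3 by (simp only: numeral_3_eq_3)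
  have CP: "C_k_on (Suc (Suc 0)) P S" and CN: "C_k_on (Suc (Suc 0)) N S"
    unfolding P_def N_def by (rule C_k_on_dd[OF S C\<phi>])+
  note D = C_k_on_differentiable_at[OF S]
  have \<phi>d: "\<phi> differentiable (at y)" and Pd: "P differentiable (at y)" and Nd: "N differentiable (at y)"
    and P'd: "dd v P differentiable (at y)" and N'd: "dd v N differentiable (at y)"
    if "y \<in> S" for y v
    using D[OF C\<phi> that] D[OF CP that] D[OF CN that] D[OF C_k_on_dd[OF S CP] that]
      D[OF C_k_on_dd[OF S CN] that] by simp_all
  have qd: "q differentiable (at y)" if "y \<in> S" for y
    unfolding q_def using Pd[OF that] Nd[OF that] by simp
  have Cd: "C differentiable (at y)" if "y \<in> S" for y
    unfolding C_def using \<phi>d[OF that] qd[OF that] by simp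
  have PN: "P y = e $ 1 * pd 1 \<phi> y + e $ 2 * pd 2 \<phi> y" "N y = n $ 1 * pd 1 \<phi> y + n $ 2 * pd 2 \<phi> y"
    if "y \<in> S" for y
    unfolding P_def N_def using \<phi>d[OF that] by (simp_all add: dd_eq_pd)
  \<comment> \<open>A constant rotation preserves the norm, so this holds throughout
    \<open>S\<close> and can be differentiated.\<close>
  have nq: "(norm (grad \<phi> y))\<^sup>2 = q y" if "y \<in> S" for y
    unfolding norm_grad_sq q_def PN[OF that] n using e by algebra
  have csq: "csq y = C y" if "y \<in> S" for y
    unfolding csq_def C_def nq[OF that] sound_speed_sq_def g_def K_def by (simp add: field_simps)
  have Cpos: "C y > 0" if "y \<in> S" for y using pos[OF that] csq[OF that] by simp
  have M: "M y = q y / C y" if "y \<in> S" for y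
  proof -
    have "M y = (norm (grad \<phi> y))\<^sup>2 / csq y"
      using pos[OF that] by (simp add: M_def pseudo_Mach_def sound_speed_def power_divide csq_def)
    then show ?thesis unfolding nq[OF that] csq[OF that] .
  qed
  have Md: "M differentiable (at y)" if "y \<in> S" for y
    by (rule differentiable_at_cong_open[OF S that M])
      (use qd[OF that] Cd[OF that] Cpos[OF that] in simp_all)

  have dq: "dd v q y = 2 * (P y * dd v P y + N y * dd v N y)" if "y \<in> S" for y v
    by (rule dd_eqI[OF S that qd[OF that] q_def])
      (rule derivative_eq_intros DERIV_dd[OF Pd[OF that]] DERIV_dd[OF Nd[OF that]] refl | simp)+
  have dq_d: "dd v q differentiable (at y)" if "y \<in> S" for y v
    by (rule differentiable_at_cong_open[OF S that dq])
      (use Pd[OF that] Nd[OF that] P'd[OF that] N'd[OF that] in simp_all)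
  have dC: "dd v C y = - g * (dd v \<phi> y + dd v q y / 2)" if "y \<in> S" for y v
    by (rule dd_eqI[OF S that Cd[OF that] C_def])
      (rule derivative_eq_intros DERIV_dd[OF \<phi>d[OF that]] DERIV_dd[OF qd[OF that]] refl | simp)+
  have d\<phi>_d: "dd v \<phi> differentiable (at y)" if "y \<in> S" for y v
    using D[OF C_k_on_dd[OF S C\<phi>] that] .
  have dC_d: "dd v C differentiable (at y)" if "y \<in> S" for y v
    by (rule differentiable_at_cong_open[OF S that dC])
      (use d\<phi>_d[OF that] dq_d[OF that] in simp_all)
  \<comment> \<open>The product form replaces the quotient: differentiating it twice yields the
    second derivatives of L^2 implicitly.\<close>
  have CM: "q y = C y * M y" if "y \<in> S" for y using M[OF that] Cpos[OF that] by simp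
  have dM: "dd v q y = dd v C y * M y + C y * dd v M y" if "y \<in> S" for y v
    by (rule dd_eqI[OF S that qd[OF that] CM])
      (rule derivative_eq_intros DERIV_dd[OF Cd[OF that]] DERIV_dd[OF Md[OF that]] refl | simp)+
  \<comment> \<open>The explicit solution serves to show that the derivative of \<open>M\<close> is
    again differentiable; its values come from the product form.\<close>
  have dM': "dd v M y = (dd v q y - dd v C y * M y) / C y" if "y \<in> S" for y v
    using dM[OF that, of v] Cpos[OF that] by (simp add: field_simps)
  have dM_d: "dd v M differentiable (at y)" if "y \<in> S" for y v
    by (rule differentiable_at_cong_open[OF S that dM'])
      (use dq_d[OF that] dC_d[OF that] Md[OF that] Cd[OF that] Cpos[OF that] in simp_all)

  have ddq: "dd v (dd v q) x = 2 * ((dd v P x)\<^sup>2 + P x * dd v (dd v P) x + (dd v N x)\<^sup>2 + N x * dd v (dd v N) x)" for v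
    by (rule dd_eqI[OF S x dq_d[OF x] dq])
      (rule derivative_eq_intros DERIV_dd[OF Pd[OF x]] DERIV_dd[OF Nd[OF x]]
        DERIV_dd[OF P'd[OF x]] DERIV_dd[OF N'd[OF x]] refl | simp add: power2_eq_square)+
  have ddC: "dd v (dd v C) x = - g * (dd v (dd v \<phi>) x + dd v (dd v q) x / 2)" for v
    by (rule dd_eqI[OF S x dC_d[OF x] dC])
      (rule derivative_eq_intros DERIV_dd[OF d\<phi>_d[OF x]] DERIV_dd[OF dq_d[OF x]] refl | simp)+
  have ddM: "dd v (dd v q) x = dd v (dd v C) x * M x + 2 * dd v C x * dd v M x + C x * dd v (dd v M) x" for v
    by (rule dd_eqI[OF S x dq_d[OF x] dM])
      (rule derivative_eq_intros DERIV_dd[OF Cd[OF x]] DERIV_dd[OF Md[OF x]]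
        DERIV_dd[OF dC_d[OF x]] DERIV_dd[OF dM_d[OF x]] refl | simp)+

  have sym: "dd e N y = dd n P y" if "y \<in> S" for y
    unfolding P_def N_def using dd_commute[OF S that C\<phi>] .
  \<comment> \<open>Both sides are \<phi>_enn. The symmetry \<open>sym\<close> holds near
    \<open>x\<close>, so it may be differentiated along \<open>n\<close>; one more exchange applies
    to \<open>N\<close>, which is C^2.\<close>
  have sym3: "dd n (dd n P) x = dd e (dd n N) x"
  proof -
    have "dd n (dd n P) x = dd n (dd e N) x"
      by (rule dd_cong_open[OF S x sym[symmetric] N'd[OF x]])
    then show ?thesis using dd_commute[OF S x CN, of n e] by simp
  qed
  \<comment> \<open>The left side of the flow equation in the frame, with all terms in
    \<open>N\<close> kept: the identity holds on \<open>S\<close> and is differentiated along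
    \<open>e\<close> before \<open>N x = 0\<close> is inserted.\<close>
  define F where "F y = C y * (dd e P y + dd n N y)
     - ((P y)\<^sup>2 * dd e P y + 2 * (P y * N y * dd n P y) + (N y)\<^sup>2 * dd n N y)" for y
  have F: "F y = q y - 2 * C y" if "y \<in> S" for y
  proof -
    have H: "dd e P y = e $ 1 * e $ 1 * pd 1 (pd 1 \<phi>) y + e $ 1 * e $ 2 * pd 1 (pd 2 \<phi>) y
        + e $ 2 * e $ 1 * pd 2 (pd 1 \<phi>) y + e $ 2 * e $ 2 * pd 2 (pd 2 \<phi>) y"
      "dd n P y = n $ 1 * e $ 1 * pd 1 (pd 1 \<phi>) y + n $ 1 * e $ 2 * pd 1 (pd 2 \<phi>) y
        + n $ 2 * e $ 1 * pd 2 (pd 1 \<phi>) y + n $ 2 * e $ 2 * pd 2 (pd 2 \<phi>) y"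
      "dd n N y = n $ 1 * n $ 1 * pd 1 (pd 1 \<phi>) y + n $ 1 * n $ 2 * pd 1 (pd 2 \<phi>) y
        + n $ 2 * n $ 1 * pd 2 (pd 1 \<phi>) y + n $ 2 * n $ 2 * pd 2 (pd 2 \<phi>) y"
      unfolding P_def N_def by (rule dd_dd_eq_pd[OF S C\<phi> that])+
    have H12: "pd 1 (pd 2 \<phi>) y = pd 2 (pd 1 \<phi>) y"
      unfolding pd_eq_dd by (rule dd_commute[OF S that C\<phi>])
    have "C y * (pd 1 (pd 1 \<phi>) y + pd 2 (pd 2 \<phi>) y)
        - (pd 1 \<phi> y * pd 1 \<phi> y * pd 1 (pd 1 \<phi>) y + pd 1 \<phi> y * pd 2 \<phi> y * pd 1 (pd 2 \<phi>) y
          + (pd 2 \<phi> y * pd 1 \<phi> y * pd 2 (pd 1 \<phi>) y + pd 2 \<phi> y * pd 2 \<phi> y * pd 2 (pd 2 \<phi>) y))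
      = q y - 2 * C y"
      using flow[OF that, unfolded potential_flow_at_def] csq[OF that] nq[OF that]
      by (simp add: Let_def csq_def laplacian_def sum_2)
    then show ?thesis unfolding F_def H H12 PN[OF that] n using e by algebra
  qed
  have Fd: "F differentiable (at x)"
    unfolding F_def using Cd[OF x] Pd[OF x] Nd[OF x] P'd[OF x] N'd[OF x] by simp
  have F1: "dd e F x = dd e q x - 2 * dd e C x"
    by (rule dd_eqI[OF S x Fd F])
      (rule derivative_eq_intros DERIV_dd[OF qd[OF x]] DERIV_dd[OF Cd[OF x]] refl | simp)+
  have Nx: "N x = 0" using grad(2) unfolding PN(2)[OF x] by (simp add: grad_def)
  have F2: "dd e F x = dd e C x * (dd e P x + dd n N x) + C x * (dd e (dd e P) x + dd e (dd n N) x)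
      - 2 * P x * dd e P x * dd e P x - (P x)\<^sup>2 * dd e (dd e P) x - 2 * P x * dd e N x * dd n P x"
    by (rule dd_eqI[OF S x Fd F_def])
      (rule derivative_eq_intros DERIV_dd[OF Pd[OF x]] DERIV_dd[OF Nd[OF x]]
        DERIV_dd[OF P'd[OF x]] DERIV_dd[OF N'd[OF x]] DERIV_dd[OF Cd[OF x]] refl
        | simp add: Nx algebra_simps)+

  have c': "c > 0" "c\<^sup>2 = C x" using Cpos[OF x] by (auto simp: c csq[OF x])
  have Px: "P x = norm (grad \<phi> x)" using grad(1) unfolding PN(1)[OF x] by (simp add: grad_def)
  have u: "P x = L * c"
    using c'(1) unfolding Px L pseudo_Mach_def sound_speed_def c csq_def by simp
  have Mx: "M x = L\<^sup>2" by (simp add: M_def L)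
  show thesis
  \<comment> \<open>The values are \<phi>_ee for \<open>s\<close>, \<phi>_nn for \<open>t\<close>
    and \<phi>_en for \<open>r\<close>.\<close>
  proof (rule that[of e n "dd e P x" "dd n N x" "dd n P x"])
    have eq: "c\<^sup>2 * (dd e P x + dd n N x) - (L * c)\<^sup>2 * dd e P x = (L * c)\<^sup>2 - 2 * c\<^sup>2"
      using F[OF x] unfolding F_def q_def Nx c'(2) u by simp
    have Ce: "dd e C x = - g * (L * c) * (1 + dd e P x)"
      unfolding dC[OF x] dq[OF x] Nx P_def[symmetric] u by (simp add: algebra_simps)
    have Cn: "dd n C x = - g * (L * c) * dd n P x"
      unfolding dC[OF x] dq[OF x] Nx N_def[symmetric] u by (simp add: algebra_simps)
    have qee: "dd e (dd e q) x = 2 * ((dd e P x)\<^sup>2 + (dd n P x)\<^sup>2 + L * c * dd e (dd e P) x)"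
      unfolding ddq sym[OF x] Nx u by simp
    have qnn: "dd n (dd n q) x = 2 * ((dd n P x)\<^sup>2 + (dd n N x)\<^sup>2 + L * c * dd n (dd n P) x)"
      unfolding ddq Nx u by simp
    have Cee: "dd e (dd e C) x = - g * (dd e P x + ((dd e P x)\<^sup>2 + (dd n P x)\<^sup>2 + L * c * dd e (dd e P) x))"
      unfolding ddC qee P_def[symmetric] by simp
    have Cnn: "dd n (dd n C) x = - g * (dd n N x + ((dd n P x)\<^sup>2 + (dd n N x)\<^sup>2 + L * c * dd n (dd n P) x))"
      unfolding ddC qnn N_def[symmetric] by simp
    have qe: "dd e q x = 2 * (L * c) * dd e P x" "dd n q x = 2 * (L * c) * dd n P x"
      unfolding dq[OF x] Nx u by simp_all
    have eq_e: "dd e C x * (dd e P x + dd n N x) + c\<^sup>2 * (dd e (dd e P) x + dd n (dd n P) x)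
        - 2 * (L * c) * (dd e P x)\<^sup>2 - (L * c)\<^sup>2 * dd e (dd e P) x - 2 * (L * c) * (dd n P x)\<^sup>2
       = 2 * (L * c) * dd e P x - 2 * dd e C x"
      using F1 F2 unfolding sym3 sym[OF x] qe c'(2) u by (simp add: power2_eq_square)
    have Me: "dd e C x * L\<^sup>2 + c\<^sup>2 * dd e M x = 2 * (L * c) * dd e P x"
      "dd n C x * L\<^sup>2 + c\<^sup>2 * dd n M x = 2 * (L * c) * dd n P x"
      using dM[OF x, of e] dM[OF x, of n] unfolding qe Mx c'(2) by simp_all
    have Mee: "dd e (dd e C) x * L\<^sup>2 + 2 * dd e C x * dd e M x + c\<^sup>2 * dd e (dd e M) x
        = 2 * ((dd e P x)\<^sup>2 + (dd n P x)\<^sup>2 + L * c * dd e (dd e P) x)"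
      using ddM[of e] unfolding qee Mx c'(2) by simp
    have Mnn: "dd n (dd n C) x * L\<^sup>2 + 2 * dd n C x * dd n M x + c\<^sup>2 * dd n (dd n M) x
        = 2 * ((dd n P x)\<^sup>2 + (dd n N x)\<^sup>2 + L * c * dd n (dd n P) x)"
      using ddM[of n] unfolding qnn Mx c'(2) by simp
    note I = mach_second_order_identity[OF c'(1) eq Ce Cn Cee Cnn eq_e Me Mee Mnn m[folded g_def] k]
    show "(e $ 1)\<^sup>2 + (e $ 2)\<^sup>2 = 1" by (rule e)
    show "(n $ 1)\<^sup>2 + (n $ 2)\<^sup>2 = 1" using e by (simp add: n add.commute)
    show "(1 - L\<^sup>2) * dd e P x + dd n N x = L\<^sup>2 - 2" by (rule I(1))
    show "c * dd e M x = 2 * L * (k * dd e P x + m)" by (rule I(2))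
    show "c * dd n M x = 2 * L * k * dd n P x" by (rule I(3))
    show "c\<^sup>2 * ((1 - L\<^sup>2) * dd e (dd e M) x + dd n (dd n M) x) =
      k * (2 * (1 + L\<^sup>2) * (dd e P x)\<^sup>2 + 2 * (2 + L\<^sup>2) * (dd n P x)\<^sup>2 + 2 * (dd n N x)\<^sup>2
        + 4 * m * L\<^sup>2 * dd e P x * (1 + dd e P x) + 2 * L * (c * dd e M x)) + 2 * m * (L\<^sup>2 - 2)
      + 2 * (\<gamma> - 1) * L * ((1 - L\<^sup>2) * (c * dd e M x) * (1 + dd e P x) + c * dd n M x * dd n P x)"
      using I(4) unfolding g_def .
  qed (use Md dM_d in auto)
qed

section \<open>Bounds by the norms of the gradient and the Hessian\<close>

text \<open>Lagrange's identity, with the square of the complementary combination dropped.\<close>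

lemma abs_unit_combination_le:
  fixes x y u v :: real
  assumes "u\<^sup>2 + v\<^sup>2 = 1"
  shows "\<bar>u * x + v * y\<bar> \<le> sqrt (x\<^sup>2 + y\<^sup>2)"
proof (rule real_le_rsqrt)
  have "(u * x + v * y)\<^sup>2 + (u * y - v * x)\<^sup>2 = (u\<^sup>2 + v\<^sup>2) * (x\<^sup>2 + y\<^sup>2)"
    by (simp add: power2_eq_square algebra_simps)
  then have "(u * x + v * y)\<^sup>2 \<le> x\<^sup>2 + y\<^sup>2"
    using zero_le_power2[of "u * y - v * x"] unfolding assms by argo
  then show "\<bar>u * x + v * y\<bar>\<^sup>2 \<le> x\<^sup>2 + y\<^sup>2" by simp
qed

lemma abs_dd_le_norm_grad:
  assumes "f differentiable (at x)" "(v $ 1)\<^sup>2 + (v $ 2)\<^sup>2 = 1"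
  shows "\<bar>dd v f x\<bar> \<le> norm (grad f x)"
proof -
  have "norm (grad f x) = sqrt ((pd 1 f x)\<^sup>2 + (pd 2 f x)\<^sup>2)"
    using norm_grad_sq[of f x] by (metis norm_ge_zero real_sqrt_unique)
  then show ?thesis
    using abs_unit_combination_le[OF assms(2)] by (simp add: dd_eq_pd[OF assms(1)])
qed

text \<open>With H the Hessian, |v . H v| \<le> |H v|, and each component \<open>h i\<close> of H v
  is bounded by the norm of a row of H. The norm on \<open>real^2^2\<close> is the Frobenius
  norm.\<close>

lemma abs_dd_dd_le_norm_hess:
  assumes "open S" "C_k_on (Suc (Suc k)) f S" "x \<in> S" and v: "(v $ 1)\<^sup>2 + (v $ 2)\<^sup>2 = 1"
  shows "\<bar>dd v (dd v f) x\<bar> \<le> norm (hess f x)"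
proof -
  define h where "h i = v $ 1 * pd i (pd 1 f) x + v $ 2 * pd i (pd 2 f) x" for i
  have row: "(h i)\<^sup>2 \<le> (norm (hess f x $ i))\<^sup>2" for i
  proof -
    have "norm (hess f x $ i) = sqrt ((pd i (pd 1 f) x)\<^sup>2 + (pd i (pd 2 f) x)\<^sup>2)"
      by (simp add: norm_vec_def L2_set_def sum_2 hess_def)
    then have "\<bar>h i\<bar> \<le> norm (hess f x $ i)"
      using abs_unit_combination_le[OF v] by (simp add: h_def)
    then show ?thesis by (metis abs_ge_zero power2_abs power_mono)
  qed
  have "dd v (dd v f) x = v $ 1 * h 1 + v $ 2 * h 2"
    by (simp add: dd_dd_eq_pd[OF assms(1-3)] h_def algebra_simps)
  also have "\<bar>\<dots>\<bar> \<le> sqrt ((h 1)\<^sup>2 + (h 2)\<^sup>2)"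
    by (rule abs_unit_combination_le[OF v])
  also have "\<dots> \<le> sqrt ((norm (hess f x $ 1))\<^sup>2 + (norm (hess f x $ 2))\<^sup>2)"
    using row[of 1] row[of 2] by simp
  also have "\<dots> = norm (hess f x)"
    by (simp add: norm_vec_def[of "hess f x"] L2_set_def sum_2)
  finally show ?thesis .
qed

lemma sound_speed_sq_pos:
  assumes "gas_density a \<gamma> q z > 0" "a > 0"
  shows "sound_speed_sq a \<gamma> q z > 0"
  using assms gas_density_pos_iff by blast

lemma pseudo_Mach_nonneg: "gas_density a \<gamma> ((norm (grad \<phi> x))\<^sup>2) (\<phi> x) > 0 \<Longrightarrow> a > 0 \<Longrightarrow> pseudo_Mach a \<gamma> \<phi> x \<ge> 0"
  using sound_speed_sq_pos unfolding pseudo_Mach_def sound_speed_def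
  by (simp add: less_imp_le)

section \<open>Exclusion of interior maxima\<close>

text \<open>A maximal value 0 means that L vanishes identically, so the content is that a positive
  maximum is impossible. Since L \<ge> 0, a maximum of L is one of L^2.\<close>

lemma mach_max_principle:
  assumes \<gamma>: "\<gamma> \<ge> -1" and a: "a > 0" and S: "open S" and C3: "C_k_on 3 \<phi> S"
    and flow: "\<forall>x\<in>S. potential_flow_at a \<gamma> \<phi> x" and sub: "\<forall>x\<in>S. pseudo_Mach a \<gamma> \<phi> x \<le> 1"
    and dens: "\<forall>x\<in>S. gas_density a \<gamma> ((norm (grad \<phi> x))\<^sup>2) (\<phi> x) > 0"
    and max: "attains_max_on (pseudo_Mach a \<gamma> \<phi>) S"
  shows "\<forall>x\<in>S. pseudo_Mach a \<gamma> \<phi> x = 0"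
proof -
  obtain x where x: "x \<in> S" and mx: "\<And>y. y \<in> S \<Longrightarrow> pseudo_Mach a \<gamma> \<phi> y \<le> pseudo_Mach a \<gamma> \<phi> x"
    using max by (auto simp: attains_max_on_def)
  define L where "L = pseudo_Mach a \<gamma> \<phi> x"
  define M where "M y = (pseudo_Mach a \<gamma> \<phi> y)\<^sup>2" for y
  define m where "m = (\<gamma> - 1) * L\<^sup>2 / 2"
  define k where "k = 1 + m"
  define c where "c = sqrt (sound_speed_sq a \<gamma> ((norm (grad \<phi> x))\<^sup>2) (\<phi> x))"
  have pos: "sound_speed_sq a \<gamma> ((norm (grad \<phi> y))\<^sup>2) (\<phi> y) > 0" if "y \<in> S" for y
    using dens that a by (intro sound_speed_sq_pos) auto
  have nn: "pseudo_Mach a \<gamma> \<phi> y \<ge> 0" if "y \<in> S" for y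
    using dens that a by (intro pseudo_Mach_nonneg) auto
  have L1: "L \<le> 1" using sub x by (simp add: L_def)
  have "\<not> L > 0"
  proof
    assume L: "L > 0"
    obtain e n s r t where
      Md: "\<And>y. y \<in> S \<Longrightarrow> M differentiable (at y)" "\<And>v y. y \<in> S \<Longrightarrow> dd v M differentiable (at y)"
      and t: "(1 - L\<^sup>2) * s + t = L\<^sup>2 - 2"
      and Me: "c * dd e M x = 2 * L * (k * s + m)" and Mn: "c * dd n M x = 2 * L * k * r"
      and E: "c\<^sup>2 * ((1 - L\<^sup>2) * dd e (dd e M) x + dd n (dd n M) x) =
      k * (2 * (1 + L\<^sup>2) * s\<^sup>2 + 2 * (2 + L\<^sup>2) * r\<^sup>2 + 2 * t\<^sup>2 + 4 * m * L\<^sup>2 * s * (1 + s)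
        + 2 * L * (c * dd e M x)) + 2 * m * (L\<^sup>2 - 2)
      + 2 * (\<gamma> - 1) * L * ((1 - L\<^sup>2) * (c * dd e M x) * (1 + s) + c * dd n M x * r)"
      by (rule mach_second_order_at_point[OF S x C3 _ pos L_def c_def m_def k_def])
        (use flow in \<open>auto simp: M_def[abs_def]\<close>)
    have "M y \<le> M x" if "y \<in> S" for y
      unfolding M_def using mx[OF that] nn[OF that] by (rule power_mono)
    note z = dd_at_max[OF S x Md(1) Md(2)[OF x] this]
    have L2: "L\<^sup>2 \<le> 1" using L L1 by (simp add: power_le_one)
    have m_ge: "m \<ge> - L\<^sup>2"
      using mult_right_mono[of "-2" "\<gamma> - 1" "L\<^sup>2"] \<gamma> by (simp add: m_def)
    \<comment> \<open>The vanishing first derivatives are divided by 2 L > 0.\<close>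
    have "k * s + m = 0" "k * r = 0" using Me Mn L by (simp_all add: z(1))
    from second_order_form_pos[OF L L1 m_ge k_def t this]
    have "c\<^sup>2 * ((1 - L\<^sup>2) * dd e (dd e M) x + dd n (dd n M) x) > 0"
      unfolding E by (simp add: z(1))
    \<comment> \<open>The bound L \<le> 1 makes the operator at worst degenerate elliptic, so its
      value at a maximum is not positive.\<close>
    moreover have "(1 - L\<^sup>2) * dd e (dd e M) x \<le> 0"
      using L2 z(2)[of e] by (simp add: mult_nonneg_nonpos)
    ultimately show False
      using z(2)[of n] by (smt (verit) mult_nonneg_nonpos zero_le_power2)
  qed
  then show ?thesis using mx nn by (force simp: L_def)
qed

text \<open>The threshold is fixed by \<gamma> before the perturbation, the domain and the solution
  are given; this order of quantifiers makes the final constant uniform.\<close>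

lemma perturbed_mach_no_max:
  fixes \<gamma> :: real
  assumes \<gamma>: "\<gamma> > -1"
  obtains d0 where "d0 > 0"
    "\<And>d c_hat a S b \<phi>. d < d0 \<Longrightarrow> c_hat \<ge> 1 \<Longrightarrow> a > 0 \<Longrightarrow> open S \<Longrightarrow> C_k_on 2 b S \<Longrightarrow>
      \<forall>x\<in>S. norm (grad b x) + c_hat * norm (hess b x) \<le> d / c_hat \<Longrightarrow> C_k_on 3 \<phi> S \<Longrightarrow>
      \<forall>x\<in>S. potential_flow_at a \<gamma> \<phi> x \<Longrightarrow> \<forall>x\<in>S. pseudo_Mach a \<gamma> \<phi> x \<le> 1 \<Longrightarrow>
      \<forall>x\<in>S. gas_density a \<gamma> ((norm (grad \<phi> x))\<^sup>2) (\<phi> x) > 0 \<Longrightarrow>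
      \<forall>x\<in>S. sound_speed a \<gamma> ((norm (grad \<phi> x))\<^sup>2) (\<phi> x) \<le> c_hat \<Longrightarrow>
      \<not> attains_max_on (\<lambda>x. (pseudo_Mach a \<gamma> \<phi> x)\<^sup>2 + b x) S"
proof -
  have "\<gamma> - 1 > -2" using \<gamma> by simp
  then obtain d0 where d0: "d0 > 0" and gt: "\<And>d L s r t B1 B2 m k :: real. d < d0 \<Longrightarrow> 0 \<le> L \<Longrightarrow> L \<le> 1 \<Longrightarrow>
     \<bar>B1\<bar> \<le> d \<Longrightarrow> \<bar>B2\<bar> \<le> d \<Longrightarrow> m = (\<gamma> - 1) * L\<^sup>2 / 2 \<Longrightarrow> k = 1 + m \<Longrightarrow> (1 - L\<^sup>2) * s + t = L\<^sup>2 - 2 \<Longrightarrow>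
     B1 = 2 * L * (k * s + m) \<Longrightarrow> B2 = 2 * L * k * r \<Longrightarrow>
     k * (2 * (1 + L\<^sup>2) * s\<^sup>2 + 2 * (2 + L\<^sup>2) * r\<^sup>2 + 2 * t\<^sup>2 + 4 * m * L\<^sup>2 * s * (1 + s) + 2 * L * B1)
      + 2 * m * (L\<^sup>2 - 2) + 2 * (\<gamma> - 1) * L * ((1 - L\<^sup>2) * B1 * (1 + s) + B2 * r) > 2 * d"
    by (rule second_order_form_gt[of "\<gamma> - 1"]) blast
  show thesis
  proof (rule that[OF d0] notI)+
    fix d c_hat a S b \<phi>
    assume d: "d < d0" and ch: "c_hat \<ge> (1::real)" and a: "a > 0" and S: "open S" and b: "C_k_on 2 b S"
      and bb: "\<forall>x\<in>S. norm (grad b x) + c_hat * norm (hess b x) \<le> d / c_hat" and C3: "C_k_on 3 \<phi> S"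
      and flow: "\<forall>x\<in>S. potential_flow_at a \<gamma> \<phi> x" and sub: "\<forall>x\<in>S. pseudo_Mach a \<gamma> \<phi> x \<le> 1"
      and dens: "\<forall>x\<in>S. gas_density a \<gamma> ((norm (grad \<phi> x))\<^sup>2) (\<phi> x) > 0"
      and cs: "\<forall>x\<in>S. sound_speed a \<gamma> ((norm (grad \<phi> x))\<^sup>2) (\<phi> x) \<le> c_hat"
      and max: "attains_max_on (\<lambda>x. (pseudo_Mach a \<gamma> \<phi> x)\<^sup>2 + b x) S"
    define M where "M y = (pseudo_Mach a \<gamma> \<phi> y)\<^sup>2" for y
    obtain x where x: "x \<in> S" and mx: "\<And>y. y \<in> S \<Longrightarrow> M y + b y \<le> M x + b x"
      using max by (auto simp: attains_max_on_def M_def)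
    define L where "L = pseudo_Mach a \<gamma> \<phi> x"
    define m where "m = (\<gamma> - 1) * L\<^sup>2 / 2"
    define k where "k = 1 + m"
    define c where "c = sqrt (sound_speed_sq a \<gamma> ((norm (grad \<phi> x))\<^sup>2) (\<phi> x))"
    have pos: "sound_speed_sq a \<gamma> ((norm (grad \<phi> y))\<^sup>2) (\<phi> y) > 0" if "y \<in> S" for y
      using dens that a by (intro sound_speed_sq_pos) auto
    have L: "0 \<le> L" "L \<le> 1"
      using sub x dens a pseudo_Mach_nonneg by (auto simp: L_def)
    have L2: "0 \<le> 1 - L\<^sup>2" "1 - L\<^sup>2 \<le> 1" using L by (simp_all add: power_le_one)
    have c: "c > 0" "c \<le> c_hat"
      using pos[OF x] cs x by (auto simp: c_def sound_speed_def)
    obtain e n s r t where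
      e: "(e $ 1)\<^sup>2 + (e $ 2)\<^sup>2 = 1" and n: "(n $ 1)\<^sup>2 + (n $ 2)\<^sup>2 = 1" and
      Md: "\<And>y. y \<in> S \<Longrightarrow> M differentiable (at y)" "\<And>v y. y \<in> S \<Longrightarrow> dd v M differentiable (at y)"
      and t: "(1 - L\<^sup>2) * s + t = L\<^sup>2 - 2"
      and Me: "c * dd e M x = 2 * L * (k * s + m)" and Mn: "c * dd n M x = 2 * L * k * r"
      and E: "c\<^sup>2 * ((1 - L\<^sup>2) * dd e (dd e M) x + dd n (dd n M) x) =
      k * (2 * (1 + L\<^sup>2) * s\<^sup>2 + 2 * (2 + L\<^sup>2) * r\<^sup>2 + 2 * t\<^sup>2 + 4 * m * L\<^sup>2 * s * (1 + s)
        + 2 * L * (c * dd e M x)) + 2 * m * (L\<^sup>2 - 2)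
      + 2 * (\<gamma> - 1) * L * ((1 - L\<^sup>2) * (c * dd e M x) * (1 + s) + c * dd n M x * r)"
      by (rule mach_second_order_at_point[OF S x C3 _ pos L_def c_def m_def k_def])
        (use flow in \<open>auto simp: M_def[abs_def]\<close>)
    have C2: "C_k_on (Suc (Suc 0)) b S" using b by (simp only: numeral_2_eq_2)
    have bd: "b differentiable (at y)" "dd v b differentiable (at y)" if "y \<in> S" for y v
      using C_k_on_differentiable_at[OF S C2 that] C_k_on_differentiable_at[OF S C_k_on_dd[OF S C2] that] .
    define f where "f y = M y + b y" for y
    have fd: "f differentiable (at y)" if "y \<in> S" for y
      unfolding f_def using Md(1)[OF that] bd(1)[OF that] by simp
    have f1: "dd v f y = dd v M y + dd v b y" if "y \<in> S" for v y
      by (rule dd_eqI[OF S that fd[OF that] f_def])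
        (rule derivative_intros DERIV_dd Md(1) bd(1) that)+
    have f'd: "dd v f differentiable (at x)" for v
      by (rule differentiable_at_cong_open[OF S x f1]) (use Md(2)[OF x] bd(2)[OF x] in simp_all)
    have f2: "dd v (dd v f) x = dd v (dd v M) x + dd v (dd v b) x" for v
      by (rule dd_eqI[OF S x f'd f1]) (rule derivative_intros DERIV_dd Md(2) bd(2) x | assumption)+
    \<comment> \<open>The first- and second-order conditions for M + b, solved for the derivatives
      of M.\<close>
    have z: "dd v M x = - dd v b x" "dd v (dd v M) x \<le> - dd v (dd v b) x" for v
      using dd_at_max[OF S x fd f'd, of v] mx f1[OF x, of v] f2[of v] by (auto simp: f_def)
    \<comment> \<open>The weights in the hypothesis give \<open>c_hat\<close> |Db| \<le>
      \<open>d\<close> and \<open>c_hat\<close>^2 |D^2 b| \<le> \<open>d\<close>. With c \<le>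
      \<open>c_hat\<close> this matches the factors c and c^2 on the first and second derivatives of
      L^2.\<close>
    have "norm (grad b x) \<le> norm (grad b x) + c_hat * norm (hess b x)" using ch by simp
    also have "\<dots> \<le> d / c_hat" using bb x by blast
    finally have g: "c_hat * norm (grad b x) \<le> d" using ch by (simp add: field_simps)
    have "c_hat * norm (hess b x) \<le> norm (grad b x) + c_hat * norm (hess b x)" by simp
    also have "\<dots> \<le> d / c_hat" using bb x by blast
    finally have h: "c_hat\<^sup>2 * norm (hess b x) \<le> d" using ch by (simp add: field_simps power2_eq_square)
    have B: "\<bar>c * dd v M x\<bar> \<le> d" if "(v $ 1)\<^sup>2 + (v $ 2)\<^sup>2 = 1" for v
    proof -
      have "\<bar>c * dd v M x\<bar> = c * \<bar>dd v b x\<bar>" using c by (simp add: z(1) abs_mult)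
      also have "\<dots> \<le> c_hat * norm (grad b x)"
        using c ch abs_dd_le_norm_grad[OF bd(1)[OF x] that] by (intro mult_mono) auto
      finally show ?thesis using g by linarith
    qed
    have B2: "c\<^sup>2 * dd v (dd v M) x \<le> d" if "(v $ 1)\<^sup>2 + (v $ 2)\<^sup>2 = 1" for v
    proof -
      have "c\<^sup>2 * dd v (dd v M) x \<le> c\<^sup>2 * norm (hess b x)"
        using z(2)[of v] abs_dd_dd_le_norm_hess[OF S C2 x that] by (intro mult_left_mono) auto
      also have "\<dots> \<le> c_hat\<^sup>2 * norm (hess b x)"
        using c by (intro mult_right_mono power_mono) auto
      finally show ?thesis using h by linarith
    qed
    have "2 * d < c\<^sup>2 * ((1 - L\<^sup>2) * dd e (dd e M) x + dd n (dd n M) x)"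
      unfolding E by (rule gt[OF d L B[OF e] B[OF n] m_def k_def t Me Mn])
    also have "\<dots> = (1 - L\<^sup>2) * (c\<^sup>2 * dd e (dd e M) x) + c\<^sup>2 * dd n (dd n M) x"
      by (simp add: algebra_simps)
    also have "\<dots> \<le> (1 - L\<^sup>2) * d + d"
      using L2(1) B2[OF e] B2[OF n] by (intro add_mono mult_left_mono) auto
    \<comment> \<open>The bound \<open>B\<close> yields \<open>d\<close> \<ge> 0, which allows 1 -
      L^2 to be replaced by 1.\<close>
    also have "\<dots> \<le> 2 * d"
      using L2 B[OF e] mult_right_mono[of "1 - L\<^sup>2" 1 d] by linarith
    finally show False by simp
  qed
qed
theorem theorem3p2:
  fixes \<gamma> :: real
  assumes "\<gamma> \<noteq> 0"
  shows
    "(\<gamma> \<ge> -1 \<longrightarrow>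
       (\<forall>a > 0. \<forall>(\<Omega> :: (real^2) set) (\<phi> :: real^2 \<Rightarrow> real).
          open \<Omega> \<and> connected \<Omega> \<and> bounded \<Omega> \<and>
          C_k_on 3 \<phi> \<Omega> \<and>
          (\<forall>x\<in>\<Omega>. potential_flow_at a \<gamma> \<phi> x) \<and>
          (\<forall>x\<in>\<Omega>. pseudo_Mach a \<gamma> \<phi> x \<le> 1) \<and>
          (\<forall>x\<in>\<Omega>. gas_density a \<gamma> ((norm (grad \<phi> x))\<^sup>2) (\<phi> x) > 0)
          \<longrightarrow> (\<forall>x\<in>\<Omega>. pseudo_Mach a \<gamma> \<phi> x = 0) \<or>
              \<not> attains_max_on (pseudo_Mach a \<gamma> \<phi>) \<Omega>))
     \<and>
     (\<gamma> > -1 \<longrightarrow>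
       (\<forall>D > 0. \<exists>C0 > 0. \<forall>a > 0. \<forall>\<Omega> :: (real^2) set.
          open \<Omega> \<and> connected \<Omega> \<and> bounded \<Omega> \<and> diameter \<Omega> \<le> D \<longrightarrow>
          (\<forall>\<delta> \<ge> 0. \<forall>c_hat \<ge> 1. \<forall>(b :: real^2 \<Rightarrow> real) (\<phi> :: real^2 \<Rightarrow> real).
             C_k_on 2 b \<Omega> \<and>
             (\<forall>x\<in>\<Omega>. norm (grad b x) + c_hat * norm (hess b x) \<le> \<delta> / c_hat) \<and>
             C_k_on 3 \<phi> \<Omega> \<and>
             (\<forall>x\<in>\<Omega>. potential_flow_at a \<gamma> \<phi> x) \<and>
             (\<forall>x\<in>\<Omega>. pseudo_Mach a \<gamma> \<phi> x \<le> 1) \<and>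
             (\<forall>x\<in>\<Omega>. gas_density a \<gamma> ((norm (grad \<phi> x))\<^sup>2) (\<phi> x) > 0) \<and>
             (\<forall>x\<in>\<Omega>. sound_speed a \<gamma> ((norm (grad \<phi> x))\<^sup>2) (\<phi> x) \<le> c_hat)
             \<longrightarrow> (\<forall>x\<in>\<Omega>. (pseudo_Mach a \<gamma> \<phi> x)\<^sup>2 \<le> C0 * \<delta>) \<or>
                 \<not> attains_max_on (\<lambda>x. (pseudo_Mach a \<gamma> \<phi> x)\<^sup>2 + b x) \<Omega>)))"
proof (intro conjI impI allI)
  fix a :: real and \<Omega> :: "(real^2) set" and \<phi> :: "real^2 \<Rightarrow> real"
  assume "\<gamma> \<ge> -1" "a > 0" and "open \<Omega> \<and> connected \<Omega> \<and> bounded \<Omega> \<and> C_k_on 3 \<phi> \<Omega> \<and>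
          (\<forall>x\<in>\<Omega>. potential_flow_at a \<gamma> \<phi> x) \<and>
          (\<forall>x\<in>\<Omega>. pseudo_Mach a \<gamma> \<phi> x \<le> 1) \<and>
          (\<forall>x\<in>\<Omega>. gas_density a \<gamma> ((norm (grad \<phi> x))\<^sup>2) (\<phi> x) > 0)"
  then show "(\<forall>x\<in>\<Omega>. pseudo_Mach a \<gamma> \<phi> x = 0) \<or> \<not> attains_max_on (pseudo_Mach a \<gamma> \<phi>) \<Omega>"
    using mach_max_principle[of \<gamma> a \<Omega> \<phi>] by blast
next
  fix D :: real
  assume "\<gamma> > -1"
  then obtain d0 where d0: "d0 > 0" and no_max:
    "\<And>d c_hat a S b \<phi>. d < d0 \<Longrightarrow> c_hat \<ge> 1 \<Longrightarrow> a > 0 \<Longrightarrow> open S \<Longrightarrow> C_k_on 2 b S \<Longrightarrow>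
      \<forall>x\<in>S. norm (grad b x) + c_hat * norm (hess b x) \<le> d / c_hat \<Longrightarrow> C_k_on 3 \<phi> S \<Longrightarrow>
      \<forall>x\<in>S. potential_flow_at a \<gamma> \<phi> x \<Longrightarrow> \<forall>x\<in>S. pseudo_Mach a \<gamma> \<phi> x \<le> 1 \<Longrightarrow>
      \<forall>x\<in>S. gas_density a \<gamma> ((norm (grad \<phi> x))\<^sup>2) (\<phi> x) > 0 \<Longrightarrow>
      \<forall>x\<in>S. sound_speed a \<gamma> ((norm (grad \<phi> x))\<^sup>2) (\<phi> x) \<le> c_hat \<Longrightarrow>
      \<not> attains_max_on (\<lambda>x. (pseudo_Mach a \<gamma> \<phi> x)\<^sup>2 + b x) S"
    by (rule perturbed_mach_no_max) blast
  \<comment> \<open>The constant is 1 / \<open>d0\<close>: for \<delta> < \<open>d0\<close> no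
    maximum exists, and for \<delta> \<ge> \<open>d0\<close> the first alternative follows from L^2
    \<le> 1.\<close>
  have *: "(\<forall>x\<in>\<Omega>. (pseudo_Mach a \<gamma> \<phi> x)\<^sup>2 \<le> 1 / d0 * \<delta>) \<or>
                 \<not> attains_max_on (\<lambda>x. (pseudo_Mach a \<gamma> \<phi> x)\<^sup>2 + b x) \<Omega>"
    if a: "a > 0" and S: "open \<Omega> \<and> connected \<Omega> \<and> bounded \<Omega> \<and> diameter \<Omega> \<le> D" and ch: "c_hat \<ge> 1"
      and H: "C_k_on 2 b \<Omega> \<and>
             (\<forall>x\<in>\<Omega>. norm (grad b x) + c_hat * norm (hess b x) \<le> \<delta> / c_hat) \<and>
             C_k_on 3 \<phi> \<Omega> \<and>
             (\<forall>x\<in>\<Omega>. potential_flow_at a \<gamma> \<phi> x) \<and>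
             (\<forall>x\<in>\<Omega>. pseudo_Mach a \<gamma> \<phi> x \<le> 1) \<and>
             (\<forall>x\<in>\<Omega>. gas_density a \<gamma> ((norm (grad \<phi> x))\<^sup>2) (\<phi> x) > 0) \<and>
             (\<forall>x\<in>\<Omega>. sound_speed a \<gamma> ((norm (grad \<phi> x))\<^sup>2) (\<phi> x) \<le> c_hat)"
    for a \<Omega> \<delta> c_hat b \<phi>
  proof (cases "\<delta> < d0")
    case True
    then show ?thesis using no_max[OF True ch a, of \<Omega> b \<phi>] S H by blast
  next
    case False
    have "(pseudo_Mach a \<gamma> \<phi> x)\<^sup>2 \<le> 1 / d0 * \<delta>" if "x \<in> \<Omega>" for x
    proof -
      have "(pseudo_Mach a \<gamma> \<phi> x)\<^sup>2 \<le> 1"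
        using H a that pseudo_Mach_nonneg by (auto intro!: power_le_one)
      also have "1 \<le> 1 / d0 * \<delta>" using False d0 by simp
      finally show ?thesis .
    qed
    then show ?thesis by blast
  qed
  show "\<exists>C0 > 0. \<forall>a > 0. \<forall>\<Omega> :: (real^2) set.
          open \<Omega> \<and> connected \<Omega> \<and> bounded \<Omega> \<and> diameter \<Omega> \<le> D \<longrightarrow>
          (\<forall>\<delta> \<ge> 0. \<forall>c_hat \<ge> 1. \<forall>(b :: real^2 \<Rightarrow> real) (\<phi> :: real^2 \<Rightarrow> real).
             C_k_on 2 b \<Omega> \<and>
             (\<forall>x\<in>\<Omega>. norm (grad b x) + c_hat * norm (hess b x) \<le> \<delta> / c_hat) \<and>
             C_k_on 3 \<phi> \<Omega> \<and>
             (\<forall>x\<in>\<Omega>. potential_flow_at a \<gamma> \<phi> x) \<and>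
             (\<forall>x\<in>\<Omega>. pseudo_Mach a \<gamma> \<phi> x \<le> 1) \<and>
             (\<forall>x\<in>\<Omega>. gas_density a \<gamma> ((norm (grad \<phi> x))\<^sup>2) (\<phi> x) > 0) \<and>
             (\<forall>x\<in>\<Omega>. sound_speed a \<gamma> ((norm (grad \<phi> x))\<^sup>2) (\<phi> x) \<le> c_hat)
             \<longrightarrow> (\<forall>x\<in>\<Omega>. (pseudo_Mach a \<gamma> \<phi> x)\<^sup>2 \<le> C0 * \<delta>) \<or>
                 \<not> attains_max_on (\<lambda>x. (pseudo_Mach a \<gamma> \<phi> x)\<^sup>2 + b x) \<Omega>)"
    by (rule exI[of _ "1 / d0"], intro conjI allI impI) (use d0 in simp, rule *)
qed

end
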